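(* Suppose that the true density $f_0$ is in the Kullback-Leibler support of the prior $\Pi$, and let $\{A_n\}_{n=1}^\infty$ be a sequence of measurable subsets of $\mathbb F$. Then the following statements are equivalent. (i) There exists a constant $\beta_0>0$ such that $e^{n\beta_0}\,\Pi(A_n\mid X_1,\dots,X_n)\to 0$ almost surely (with respect to $P_{f_0}^\infty$) as $n\to\infty$. (ii) There exists a constant $\beta_1>0$ such that $$P^\infty_{f_0}\big\{\Pi(A_n\mid X_1,\dots,X_n)> e^{-n\beta_1}\ \text{infinitely often}\big\}=0.$$ (iii) There exist constants $0<\alpha_1\leq 1$, $\beta_2>0$ and a sequence $\{D_n\}_{n=1}^\infty$ of measurable sets $D_n\subset \mathbb X^n$ with $P^\infty_{f_0}(\limsup D_n)=0$ such that $$E_{f_0}\Big(1_{\mathbb X^n\setminus D_n}\int_{A_n}R_n(f)\,\Pi(df)\Big)^{\alpha_1}\leq e^{-n\beta_2}\quad\text{for all large } n.$$ (iv) For each $0<\alpha\leq 1$ there exist a constant $\beta_\alpha>0$ and a sequence $\{D_n\}_{n=1}^\infty$ of measurable sets $D_n\subset\mathbb X^n$ with $P^\infty_{f_0}(\limsup D_n)=0$ such that $$E_{f_0}\Big(1_{\mathbb X^n\setminus D_n}\int_{A_n}R_n(f)\,\Pi(df)\Big)^{\alpha}\leq e^{-n\beta_\alpha}\quad\text{for all large } n.$$ (v) There exist a constant $\beta_3>0$ and a sequence $\{D_n\}_{n=1}^\infty$ of measurable sets $D_n\subset\mathbb X^n$ such that $P^\infty_{f_0}(\limsup D_n)=0$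 and $$\int_{A_n}P^\infty_f(\mathbb X^n\setminus D_n)\,\Pi(df)\leq e^{-n\beta_3}\quad\text{for all large } n.$$
   Context: Setting. $\mathbb X$ is a Polish space with a $\sigma$-algebra $\mathcal X$ and $\mu$ is a $\sigma$-finite measure on $\mathbb X$. $\mathbb F$ is the space of probability densities with respect to $\mu$, assumed separable for the Hellinger metric $H(f,g)=\big(\int_{\mathbb X}(\sqrt{f}-\sqrt{g})^2\,d\mu\big)^{1/2}$, and equipped with its Borel $\sigma$-algebra $\mathcal F$. A prior $\Pi$ is a probability measure on $(\mathbb F,\mathcal F)$. Versions of densities are taken so that $(x,f)\mapsto f(x)$ is jointly measurable. $X_1,X_2,\dots$ are i.i.d. $\mathbb X$-valued with true density $f_0\in\mathbb F$. For a density $f$, $P_f$ is the distribution with density $f$ and $P_f^\infty$ is the infinite product of $P_f$ on $\mathbb X^\infty$. Likelihood ratio: $R_n(f)=\prod_{i=1}^n f(X_i)/f_0(X_i)$. Posterior: for measurable $A\subset\mathbb F$, $$\Pi(A\mid X_1,\dots,X_n)=\frac{\int_A\prod_{i=1}^n f(X_i)\,\Pi(df)}{\int_{\mathbb F}\prod_{i=1}^n f(X_i)\,\Pi(df)}=\frac{\int_A R_n(f)\,\Pi(df)}{\int_{\mathbb F}R_n(f)\,\Pi(df)}.$$ Kullback-Leibler divergence: $K(f,g)=\int_{\mathbb X} f\log(f/g)\,d\mu$. The density $f_0$ is in the Kullback-Leibler support of $\Pi$ if $\Pi(f: K(f_0,f)<\varepsilon)>0$ for every $\varepsilon>0$. For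 $D\subset\mathbb X^n$, $P_f^\infty(D)$ means $P_f^\infty\{(x_1,x_2,\dots): (x_1,\dots,x_n)\in D\}$, and $1_D$ is the indicator of $\{(X_1,\dots,X_n)\in D\}$. $E_{f_0}$ is expectation with respect to $X_1,\dots,X_n$ i.i.d. with density $f_0$. For sets $D_n\subset\mathbb X^n$, $\limsup D_n=\{(x_1,x_2,\dots)\in\mathbb X^\infty: (x_1,\dots,x_n)\in D_n \text{ infinitely often}\}$. *)

theory Defs
  imports "HOL-Probability.Probability"
begin

section \<open>Spaces of probability densities\<close>

definition prob_densities :: "'a measure \<Rightarrow> ('a \<Rightarrow> real) set" where
  "prob_densities \<mu> =
     {f \<in> borel_measurable \<mu>. (\<forall>x. 0 \<le> f x) \<and> (\<integral>\<^sup>+x. ennreal (f x) \<partial>\<mu>) = 1}"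

text \<open>
  Densities that agree almost everywhere are the same point of the space of densities.
  That space is represented by a set of functions containing exactly one version of every
  probability density, so that evaluating a point of the space at \<open>x\<close> makes sense.
\<close>

definition versions_of_densities :: "'a measure \<Rightarrow> ('a \<Rightarrow> real) set \<Rightarrow> bool" where
  "versions_of_densities \<mu> F \<longleftrightarrow>
     F \<subseteq> prob_densities \<mu> \<and>
     (\<forall>g \<in> prob_densities \<mu>. \<exists>!f. f \<in> F \<and> (AE x in \<mu>. f x = g x))"

definition hellinger :: "'a measure \<Rightarrow> ('a \<Rightarrow> real) \<Rightarrow> ('a \<Rightarrow> real) \<Rightarrow> real" where
  "hellinger \<mu> f g = sqrt (\<integral>x. (sqrt (f x) - sqrt (g x))\<^sup>2 \<partial>\<mu>)"

abbreviation hellinger_topology ::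
    "'a measure \<Rightarrow> ('a \<Rightarrow> real) set \<Rightarrow> ('a \<Rightarrow> real) topology" where
  "hellinger_topology \<mu> F \<equiv> Metric_space.mtopology F (hellinger \<mu>)"

definition hellinger_borel ::
    "'a measure \<Rightarrow> ('a \<Rightarrow> real) set \<Rightarrow> ('a \<Rightarrow> real) measure" where
  "hellinger_borel \<mu> F = sigma F {U. openin (hellinger_topology \<mu> F) U}"

lemma integrable_hellinger:
  assumes "f \<in> prob_densities \<mu>" "g \<in> prob_densities \<mu>"
  shows "integrable \<mu> (\<lambda>x. (sqrt (f x) - sqrt (g x))\<^sup>2)"
proof -
  have [measurable]: "f \<in> borel_measurable \<mu>" "g \<in> borel_measurable \<mu>"
    and nonneg: "\<And>x. 0 \<le> f x" "\<And>x. 0 \<le> g x"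
    using assms by (auto simp: prob_densities_def)
  have "integrable \<mu> f" "integrable \<mu> g"
    using assms by (simp_all add: prob_densities_def integrableI_nonneg)
  then have int: "integrable \<mu> (\<lambda>x. f x + g x)"
    by simp
  have "(sqrt (f x) - sqrt (g x))\<^sup>2 \<le> f x + g x" for x
    using nonneg[of x] by (simp add: power2_diff)
  then show ?thesis
    using nonneg by (intro Bochner_Integration.integrable_bound[OF int]) auto
qed

lemma hellinger_triangle:
  assumes f: "f \<in> prob_densities \<mu>" and g: "g \<in> prob_densities \<mu>" and h: "h \<in> prob_densities \<mu>"
  shows "hellinger \<mu> f h \<le> hellinger \<mu> f g + hellinger \<mu> g h"
proof -
  define a where "a = (\<lambda>x. sqrt (f x) - sqrt (g x))"
  define b where "b = (\<lambda>x. sqrt (g x) - sqrt (h x))"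
  have int: "integrable \<mu> (\<lambda>x. (a x)\<^sup>2)" "integrable \<mu> (\<lambda>x. (b x)\<^sup>2)"
    "integrable \<mu> (\<lambda>x. (a x + b x)\<^sup>2)"
    using integrable_hellinger[OF f g] integrable_hellinger[OF g h] integrable_hellinger[OF f h]
    by (simp_all add: a_def b_def)
  let ?A = "\<integral>x. (a x)\<^sup>2 \<partial>\<mu>" and ?B = "\<integral>x. (b x)\<^sup>2 \<partial>\<mu>"
  have "sqrt (\<integral>x. (a x + b x)\<^sup>2 \<partial>\<mu>) \<le> sqrt ?A + sqrt ?B + e" if "e > 0" for e
  proof -
    define s where "s = sqrt ?A + e / 2"
    define t where "t = sqrt ?B + e / 2"
    have A: "0 \<le> ?A" and B: "0 \<le> ?B" by auto
    have s: "s > 0" and t: "t > 0"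
      using A B that by (simp_all add: s_def t_def add_nonneg_pos)
    have As: "?A \<le> s\<^sup>2" and Bt: "?B \<le> t\<^sup>2"
      using A B that by (auto simp: s_def t_def intro!: real_le_rsqrt sqrt_le_D)
    have "(u + v)\<^sup>2 \<le> (1 + t / s) * u\<^sup>2 + (1 + s / t) * v\<^sup>2" for u v :: real
    proof -
      have "(1 + t / s) * u\<^sup>2 + (1 + s / t) * v\<^sup>2 - (u + v)\<^sup>2 = (t * u - s * v)\<^sup>2 / (s * t)"
        using s t by (simp add: field_simps power2_eq_square)
      moreover have "\<dots> \<ge> 0" using s t by simp
      ultimately show ?thesis by linarith
    qed
    then have "(\<integral>x. (a x + b x)\<^sup>2 \<partial>\<mu>) \<le> (\<integral>x. (1 + t / s) * (a x)\<^sup>2 + (1 + s / t) * (b x)\<^sup>2 \<partial>\<mu>)"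
      using int by (intro integral_mono) auto
    also have "\<dots> = (1 + t / s) * ?A + (1 + s / t) * ?B"
      using int by simp
    also have "\<dots> \<le> (1 + t / s) * s\<^sup>2 + (1 + s / t) * t\<^sup>2"
      using s t As Bt by (intro add_mono mult_left_mono) auto
    also have "\<dots> = (s + t)\<^sup>2"
      using s t by (simp add: field_simps power2_eq_square)
    finally have "sqrt (\<integral>x. (a x + b x)\<^sup>2 \<partial>\<mu>) \<le> s + t"
      using s t by (intro real_le_lsqrt) auto
    then show ?thesis by (simp add: s_def t_def)
  qed
  then have "sqrt (\<integral>x. (a x + b x)\<^sup>2 \<partial>\<mu>) \<le> sqrt ?A + sqrt ?B"
    by (rule field_le_epsilon)
  then show ?thesis
    by (simp add: hellinger_def a_def b_def)
qed

lemma Metric_space_hellinger: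
  assumes "versions_of_densities \<mu> F"
  shows "Metric_space F (hellinger \<mu>)"
proof
  have dens: "f \<in> prob_densities \<mu>" if "f \<in> F" for f
    using assms that by (auto simp: versions_of_densities_def)
  fix f g h
  show "0 \<le> hellinger \<mu> f g"
    by (simp add: hellinger_def)
  show "hellinger \<mu> f g = hellinger \<mu> g f"
    by (simp add: hellinger_def power2_commute)
  assume f: "f \<in> F" and g: "g \<in> F"
  show "hellinger \<mu> f g = 0 \<longleftrightarrow> f = g"
  proof
    assume "hellinger \<mu> f g = 0"
    then have "(\<integral>x. (sqrt (f x) - sqrt (g x))\<^sup>2 \<partial>\<mu>) = 0"
      by (simp add: hellinger_def)
    then have "AE x in \<mu>. (sqrt (f x) - sqrt (g x))\<^sup>2 = 0"
      using integrable_hellinger[OF dens[OF f] dens[OF g]]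
      by (subst (asm) integral_nonneg_eq_0_iff_AE) auto
    then have "AE x in \<mu>. f x = g x"
      by simp
    moreover have "AE x in \<mu>. g x = g x" by simp
    ultimately show "f = g"
      using assms f g dens[OF g] unfolding versions_of_densities_def by blast
  qed (simp add: hellinger_def)
  assume h: "h \<in> F"
  show "hellinger \<mu> f h \<le> hellinger \<mu> f g + hellinger \<mu> g h"
    using hellinger_triangle[OF dens[OF f] dens[OF g] dens[OF h]] .
qed


section \<open>Kullback-Leibler divergence\<close>

text \<open>
  The conventions are \<open>0 log (0/b) = 0\<close> and \<open>a log (a/0) = \<infinity>\<close> for \<open>a > 0\<close>.
  The integral is the difference of the integrals of the positive and negative parts; it is not
  the Bochner integral (nor \<^const>\<open>KL_divergence\<close>), which would be \<open>0\<close> where the divergence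
  is infinite.
\<close>

definition kl_integrand :: "real \<Rightarrow> real \<Rightarrow> ereal" where
  "kl_integrand a b = (if a = 0 then 0 else if b = 0 then \<infinity> else ereal (a * ln (a / b)))"

definition kl_div :: "'a measure \<Rightarrow> ('a \<Rightarrow> real) \<Rightarrow> ('a \<Rightarrow> real) \<Rightarrow> ereal" where
  "kl_div \<mu> f g =
     enn2ereal (\<integral>\<^sup>+x. e2ennreal (kl_integrand (f x) (g x)) \<partial>\<mu>) -
     enn2ereal (\<integral>\<^sup>+x. e2ennreal (- kl_integrand (f x) (g x)) \<partial>\<mu>)"

definition kl_support ::
    "'a measure \<Rightarrow> ('a \<Rightarrow> real) measure \<Rightarrow> ('a \<Rightarrow> real) \<Rightarrow> bool" where
  "kl_support \<mu> prior f0 \<longleftrightarrow>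
     (\<forall>\<epsilon>>0. emeasure prior {f \<in> space prior. kl_div \<mu> f0 f < ereal \<epsilon>} > 0)"


section \<open>Observations, likelihood ratio and posterior\<close>

text \<open>
  A sample path \<open>\<omega>\<close> is numbered from \<open>0\<close>, so the first \<open>n\<close> observations are the values of
  \<open>\<omega>\<close> on \<open>{..<n}\<close>.
\<close>

definition iid_law :: "'a measure \<Rightarrow> ('a \<Rightarrow> real) \<Rightarrow> (nat \<Rightarrow> 'a) measure" where
  "iid_law \<mu> f = (\<Pi>\<^sub>M i\<in>UNIV. density \<mu> (\<lambda>x. ennreal (f x)))"

abbreviation sample_space :: "'a measure \<Rightarrow> nat \<Rightarrow> (nat \<Rightarrow> 'a) measure" where
  "sample_space \<mu> n \<equiv> (\<Pi>\<^sub>M i\<in>{..<n}. \<mu>)"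

definition cylinder :: "nat \<Rightarrow> (nat \<Rightarrow> 'a) set \<Rightarrow> (nat \<Rightarrow> 'a) set" where
  "cylinder n D = {\<omega>. restrict \<omega> {..<n} \<in> D}"

definition limsup_cylinders :: "(nat \<Rightarrow> (nat \<Rightarrow> 'a) set) \<Rightarrow> (nat \<Rightarrow> 'a) set" where
  "limsup_cylinders D = {\<omega>. \<exists>\<^sub>\<infinity>n. \<omega> \<in> cylinder n (D n)}"

definition likelihood_ratio ::
    "('a \<Rightarrow> real) \<Rightarrow> nat \<Rightarrow> (nat \<Rightarrow> 'a) \<Rightarrow> ('a \<Rightarrow> real) \<Rightarrow> real" where
  "likelihood_ratio f0 n \<omega> f = (\<Prod>i<n. f (\<omega> i) / f0 (\<omega> i))"

definition posterior ::
    "('a \<Rightarrow> real) measure \<Rightarrow> nat \<Rightarrow> (nat \<Rightarrow> 'a) \<Rightarrow> ('a \<Rightarrow> real) set \<Rightarrow> ennreal" where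
  "posterior prior n \<omega> A =
     (\<integral>\<^sup>+f\<in>A. ennreal (\<Prod>i<n. f (\<omega> i)) \<partial>prior) / (\<integral>\<^sup>+f. ennreal (\<Prod>i<n. f (\<omega> i)) \<partial>prior)"

definition ennreal_powr :: "ennreal \<Rightarrow> real \<Rightarrow> ennreal" where
  "ennreal_powr x \<alpha> = (if x = \<infinity> then \<infinity> else ennreal (enn2real x powr \<alpha>))"

definition truncated_moment ::
    "'a measure \<Rightarrow> ('a \<Rightarrow> real) measure \<Rightarrow> ('a \<Rightarrow> real) \<Rightarrow> ('a \<Rightarrow> real) set \<Rightarrow>
     nat \<Rightarrow> (nat \<Rightarrow> 'a) set \<Rightarrow> real \<Rightarrow> ennreal" where
  "truncated_moment \<mu> prior f0 A n D \<alpha> =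
     (\<integral>\<^sup>+\<omega>. ennreal_powr
         (indicator (cylinder n (space (sample_space \<mu> n) - D)) \<omega> *
          (\<integral>\<^sup>+f\<in>A. ennreal (likelihood_ratio f0 n \<omega> f) \<partial>prior)) \<alpha>
      \<partial>iid_law \<mu> f0)"

end

theory Submission
  imports Defs
begin

text \<open>
  All five conditions compare the numerator \<open>\<integral>\<^sub>A R\<^sub>n d\<Pi>\<close> of the posterior with exponentials; the
  denominator \<open>\<integral> R\<^sub>n d\<Pi>\<close> is harmless because it is neither large nor small on the exponential scale.

  It is not large because its expectation under the true law is at most one
  (\<open>nn_integral_avg_ratio_le_1\<close>).  Hence, if \<open>D\<^sub>n\<close> is the event that the posterior mass exceeds
  \<open>c = exp (- n \<beta>)\<close>, then off \<open>D\<^sub>n\<close> the numerator is at most \<open>c\<close> times the denominator, and its power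
  \<open>\<alpha>\<close> has expectation at most \<open>2 c\<^sup>\<alpha>\<close> (\<open>truncated_moment_of_null\<close>).

  It is not small because of the Kullback-Leibler support: for every \<open>\<epsilon> > 0\<close>, almost surely,
  \<open>\<integral> R\<^sub>n d\<Pi> \<ge> c exp (- n \<epsilon>)\<close> for all \<open>n\<close> and some random \<open>c > 0\<close> (\<open>AE_avg_ratio_lower_bound\<close>).
  For a single \<open>f\<close> with \<open>K(f\<^sub>0, f) < \<epsilon>\<close>, the sum of the variables \<open>ln (f\<^sub>0 / f) - \<epsilon>\<close>, which have
  negative mean, stays bounded above, so that \<open>R\<^sub>n(f) exp (n \<epsilon>)\<close> has a positive infimum over \<open>n\<close>.
  By Fubini, almost surely this holds for almost all such \<open>f\<close> at once, and the infimum, integrated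
  over a set of positive prior mass, gives \<open>c\<close>.  Boundedness of the sums is the half of the
  strong law of large numbers that is needed; it has a short direct proof in the style of the
  maximal ergodic theorem (\<open>AE_bdd_above_partial_sums\<close>).  An exponentially small truncated moment makes
  the numerator exponentially small almost surely, by the Markov inequality and Borel-Cantelli, and
  dividing by the lower bound gives posterior decay (\<open>posterior_decay_of_truncated_moment\<close>).

  Finally, the first truncated moment is itself a prior average of error probabilities: exchanging
  the integrals and changing measure,
  \<open>E\<^sub>0 (1\<^sub>E \<integral>\<^sub>A R\<^sub>n d\<Pi>) = \<integral>\<^sub>A P\<^sub>f(E \<inter> {\<Prod> f\<^sub>0 > 0}) \<Pi>(df)\<close> (\<open>nn_integral_avg_ratio\<close>).  The samples
  with \<open>\<Prod> f\<^sub>0 = 0\<close> have probability zero under the true law and can be added to \<open>D\<^sub>n\<close>, so that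
  the fifth condition is the third with exponent one.
\<close>

section \<open>Partial sums of independent variables with negative mean\<close>

text \<open>
  This is the maximum of the partial sums of \<open>z (\<omega> i)\<close> with at most \<open>n\<close> terms, written as a recursion on
  the shifted sequence, because the proof below compares \<open>running_max\<close> at \<open>\<omega>\<close> and at its shift.
\<close>

primrec running_max :: "('a \<Rightarrow> real) \<Rightarrow> nat \<Rightarrow> (nat \<Rightarrow> 'a) \<Rightarrow> real" where
  "running_max z 0 \<omega> = 0"
| "running_max z (Suc n) \<omega> = max 0 (z (\<omega> 0) + running_max z n (\<lambda>i. \<omega> (Suc i)))"

lemma sum_le_running_max:
  "k \<le> n \<Longrightarrow> (\<Sum>i<k. z (\<omega> i)) \<le> running_max z n \<omega>"
proof (induction n arbitrary: k \<omega>)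
  case (Suc n)
  show ?case
  proof (cases k)
    case (Suc m)
    then have "(\<Sum>i<m. z (\<omega> (Suc i))) \<le> running_max z n (\<lambda>i. \<omega> (Suc i))"
      using Suc.IH[of m "\<lambda>i. \<omega> (Suc i)"] Suc.prems by simp
    then show ?thesis
      by (simp add: Suc sum.lessThan_Suc_shift del: sum.lessThan_Suc)
  qed simp
qed simp

lemma running_max_nonneg: "0 \<le> running_max z n \<omega>"
  by (cases n) auto

lemma incseq_running_max: "incseq (\<lambda>n. running_max z n \<omega>)"
proof (rule incseq_SucI)
  show "running_max z n \<omega> \<le> running_max z (Suc n) \<omega>" for n
  proof (induction n arbitrary: \<omega>)
    case (Suc n)
    from Suc[of "\<lambda>i. \<omega> (Suc i)"] show ?case
      by (simp add: max_def split: if_splits)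
  qed simp
qed

lemma running_max_le_sum_abs: "running_max z n \<omega> \<le> (\<Sum>i<n. \<bar>z (\<omega> i)\<bar>)"
proof (induction n arbitrary: \<omega>)
  case (Suc n)
  have "0 \<le> (\<Sum>i<n. \<bar>z (\<omega> (Suc i))\<bar>)"
    by (intro sum_nonneg) auto
  with Suc[of "\<lambda>i. \<omega> (Suc i)"] show ?case
    by (simp add: sum.lessThan_Suc_shift del: sum.lessThan_Suc)
qed simp

context sequence_space
begin

lemma measurable_shift [measurable]: "(\<lambda>\<omega> i. \<omega> (Suc i)) \<in> S \<rightarrow>\<^sub>M S"
  by (rule measurable_PiM_single') (auto simp: space_PiM)

lemma borel_measurable_running_max [measurable]:
  assumes [measurable]: "z \<in> borel_measurable M"
  shows "running_max z n \<in> borel_measurable S"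
proof (induction n)
  case (Suc n)
  note [measurable] = measurable_compose[OF measurable_shift Suc]
  show ?case by simp
qed simp

lemma integrable_running_max:
  assumes "integrable M z"
  shows "integrable S (running_max z n)"
proof (rule Bochner_Integration.integrable_bound)
  have "integrable S (\<lambda>\<omega>. z (\<omega> i))" for i
    using assms PiM_component[of i]
      integrable_distr_eq[of "\<lambda>\<omega>. \<omega> i" S M z]
    by auto
  then show "integrable S (\<lambda>\<omega>. \<Sum>i<n. \<bar>z (\<omega> i)\<bar>)"
    by (intro Bochner_Integration.integrable_sum integrable_abs)
  show "running_max z n \<in> borel_measurable S"
    using assms by measurable
  show "AE \<omega> in S. norm (running_max z n \<omega>) \<le> norm (\<Sum>i<n. \<bar>z (\<omega> i)\<bar>)"
    using running_max_le_sum_abs[of z n] running_max_nonneg[of z n]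
    by (intro AE_I2) (simp add: sum_nonneg)
qed

text \<open>
  Let \<open>M n\<close> be the running maximum and \<open>U\<close> the event that it is unbounded.  On the sequence \<open>x, \<omega>\<close> that
  puts a value \<open>x\<close> in front of \<open>\<omega>\<close>, the value of \<open>M (n + 1)\<close> is \<open>max 0 (z x + M n \<omega>)\<close>, and \<open>U\<close> holds
  there if and only if it holds at \<open>\<omega>\<close>.  If \<open>x\<close> is independent of \<open>\<omega>\<close>, the longer sequence has the
  same law as \<open>\<omega>\<close>.  So the expectation over \<open>U\<close> of
  \<open>max 0 (z x + M n \<omega>) - M n \<omega> = max (z x) (- M n \<omega>)\<close> equals that of \<open>M (n + 1) - M n\<close> and is nonnegative.
  As \<open>n\<close> grows the integrand converges to \<open>z x\<close> on \<open>U\<close>, dominated by \<open>\<bar>z x\<bar>\<close>, and \<open>x\<close> is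
  independent of \<open>U\<close>; in the limit \<open>0 \<le> P(U) E z\<close>, so \<open>P(U) = 0\<close>.
\<close>

lemma AE_bdd_above_partial_sums:
  fixes z :: "'a \<Rightarrow> real"
  assumes int: "integrable M z" and neg: "(\<integral>x. z x \<partial>M) < 0"
  shows "AE \<omega> in S. bdd_above (range (\<lambda>n. \<Sum>i<n. z (\<omega> i)))"
proof -
  interpret MS: pair_prob_space M S ..
  have [measurable]: "z \<in> borel_measurable M"
    using int by auto
  define U where "U = {\<omega> \<in> space S. \<forall>C::nat. \<exists>n. real C < running_max z n \<omega>}"
  have [measurable]: "U \<in> sets S"
    unfolding U_def by measurable
  have [measurable]: "(\<lambda>p. case_nat (fst p) (snd p)) \<in> M \<Otimes>\<^sub>M S \<rightarrow>\<^sub>M S"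
    by (rule measurable_case_nat') measurable
  \<comment> \<open>Prefixing one value changes all running maxima by at most \<open>\<bar>z x\<bar>\<close>, up to the shift of \<open>n\<close>.\<close>
  have U_shift: "case_nat x \<omega> \<in> U \<longleftrightarrow> \<omega> \<in> U" if x: "x \<in> space M" and \<omega>: "\<omega> \<in> space S" for x \<omega>
  proof -
    have sp: "case_nat x \<omega> \<in> space S"
      using x \<omega> by (auto simp: space_PiM PiE_iff split: nat.split)
    have step: "running_max z (Suc n) (case_nat x \<omega>) = max 0 (z x + running_max z n \<omega>)" for n
      by simp
    show ?thesis
    proof
      assume *: "case_nat x \<omega> \<in> U"
      have "\<exists>n. real C < running_max z n \<omega>" for C :: nat
      proof -
        obtain C' :: nat where C': "real C + \<bar>z x\<bar> < real C'"
          using reals_Archimedean2 by blast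
        obtain n where n: "real C' < running_max z n (case_nat x \<omega>)"
          using * by (auto simp: U_def)
        then obtain m where "n = Suc m"
          by (cases n) auto
        with n C' have "real C < running_max z m \<omega>"
          by (simp del: running_max.simps add: step)
        then show ?thesis ..
      qed
      with \<omega> show "\<omega> \<in> U" by (simp add: U_def)
    next
      assume *: "\<omega> \<in> U"
      have "\<exists>n. real C < running_max z n (case_nat x \<omega>)" for C :: nat
      proof -
        obtain C' :: nat where C': "real C + \<bar>z x\<bar> < real C'"
          using reals_Archimedean2 by blast
        obtain n where n: "real C' < running_max z n \<omega>"
          using * by (auto simp: U_def)
        with C' have "real C < running_max z (Suc n) (case_nat x \<omega>)"
          by (simp del: running_max.simps add: step)
        then show ?thesis ..
      qed
      with sp show "case_nat x \<omega> \<in> U" by (simp add: U_def)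
    qed
  qed
  let ?g = "\<lambda>n \<omega>. indicator U \<omega> * running_max z n \<omega>"
  have int_g: "integrable S (?g n)" for n
    using integrable_running_max[OF int, of n]
    by (simp add: integrable_mult_indicator[where 'b=real, unfolded real_scaleR_def])
  have int_g_Suc: "integrable (M \<Otimes>\<^sub>M S) (\<lambda>p. ?g (Suc n) (case_nat (fst p) (snd p)))" for n
    using int_g[of "Suc n"] PiM_iter
      integrable_distr_eq[of "\<lambda>p. case_nat (fst p) (snd p)" "M \<Otimes>\<^sub>M S" S "?g (Suc n)"]
    by (simp add: case_prod_beta' del: running_max.simps)
  have g_Suc: "(\<integral>\<omega>. ?g (Suc n) \<omega> \<partial>S) = (\<integral>p. ?g (Suc n) (case_nat (fst p) (snd p)) \<partial>(M \<Otimes>\<^sub>M S))" for n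
    using PiM_iter integral_distr[of "\<lambda>p. case_nat (fst p) (snd p)" "M \<Otimes>\<^sub>M S" S "?g (Suc n)"]
    by (simp add: case_prod_beta' del: running_max.simps)
  have fst: "distr (M \<Otimes>\<^sub>M S) M fst = M"
    by (rule P.distr_pair_fst)
  have snd: "distr (M \<Otimes>\<^sub>M S) S snd = S"
  proof (rule measure_eqI)
    fix A assume "A \<in> sets (distr (M \<Otimes>\<^sub>M S) S snd)"
    then have A: "A \<in> sets S" by simp
    then have "snd -` A \<inter> space (M \<Otimes>\<^sub>M S) = space M \<times> A"
      using sets.sets_into_space[OF A] by (auto simp: space_pair_measure)
    with A show "emeasure (distr (M \<Otimes>\<^sub>M S) S snd) A = emeasure S A"
      by (simp add: emeasure_distr P.emeasure_pair_measure_Times M.emeasure_space_1)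
  qed simp
  have int_z: "integrable (M \<Otimes>\<^sub>M S) (\<lambda>p. z (fst p))"
    using int fst integrable_distr_eq[of fst "M \<Otimes>\<^sub>M S" M z] by simp
  have int_snd: "integrable (M \<Otimes>\<^sub>M S) (\<lambda>p. ?g n (snd p))" for n
    using int_g[of n] snd integrable_distr_eq[of snd "M \<Otimes>\<^sub>M S" S "?g n"] by simp
  have g_snd: "(\<integral>\<omega>. ?g n \<omega> \<partial>S) = (\<integral>p. ?g n (snd p) \<partial>(M \<Otimes>\<^sub>M S))" for n
    using snd integral_distr[of snd "M \<Otimes>\<^sub>M S" S "?g n"] by simp
  let ?d = "\<lambda>n p. indicator U (snd p) * max (z (fst p)) (- running_max z n (snd p))"
  \<comment> \<open>The first difference of the running maximum, rewritten so that its limit on \<open>U\<close> is visible.\<close>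
  have d_eq: "?d n p = ?g (Suc n) (case_nat (fst p) (snd p)) - ?g n (snd p)"
    if "p \<in> space (M \<Otimes>\<^sub>M S)" for n p
  proof -
    have "indicator U (case_nat (fst p) (snd p)) = (indicator U (snd p) :: real)"
      using U_shift[of "fst p" "snd p"] that by (auto simp: space_pair_measure indicator_def)
    then show ?thesis
      by (auto simp: algebra_simps max_def split: split_indicator)
  qed
  have d_nonneg: "0 \<le> (\<integral>p. ?d n p \<partial>(M \<Otimes>\<^sub>M S))" for n
  proof -
    have "(\<integral>p. ?d n p \<partial>(M \<Otimes>\<^sub>M S))
      = (\<integral>p. ?g (Suc n) (case_nat (fst p) (snd p)) - ?g n (snd p) \<partial>(M \<Otimes>\<^sub>M S))"
      by (rule Bochner_Integration.integral_cong[OF refl d_eq])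
    also have "\<dots> = (\<integral>\<omega>. ?g (Suc n) \<omega> \<partial>S) - (\<integral>\<omega>. ?g n \<omega> \<partial>S)"
      unfolding g_Suc g_snd by (rule Bochner_Integration.integral_diff[OF int_g_Suc int_snd])
    also have "\<dots> \<ge> 0"
      using integral_mono[OF int_g int_g mult_left_mono[OF incseq_SucD[OF incseq_running_max]]]
      by (simp del: running_max.simps)
    finally show ?thesis .
  qed
  have lim: "(\<lambda>n. \<integral>p. ?d n p \<partial>(M \<Otimes>\<^sub>M S)) \<longlonglongrightarrow> (\<integral>p. indicator U (snd p) * z (fst p) \<partial>(M \<Otimes>\<^sub>M S))"
  proof (rule integral_dominated_convergence[where w = "\<lambda>p. \<bar>z (fst p)\<bar>"])
    show "integrable (M \<Otimes>\<^sub>M S) (\<lambda>p. \<bar>z (fst p)\<bar>)"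
      using int_z by simp
    show "AE p in M \<Otimes>\<^sub>M S. norm (?d n p) \<le> \<bar>z (fst p)\<bar>" for n
    proof (rule AE_I2)
      fix p
      show "norm (?d n p) \<le> \<bar>z (fst p)\<bar>"
        using running_max_nonneg[of z n "snd p"] by (simp add: max_def abs_if split: split_indicator)
    qed
    have "(\<lambda>n. ?d n (x, \<omega>)) \<longlonglongrightarrow> indicator U \<omega> * z x" for x \<omega>
    proof (cases "\<omega> \<in> U")
      case True
      obtain C :: nat where C: "\<bar>z x\<bar> < real C"
        using reals_Archimedean2 by blast
      obtain N where N: "real C < running_max z N \<omega>"
        using True by (auto simp: U_def)
      have "max (z x) (- running_max z n \<omega>) = z x" if "n \<ge> N" for n
        using incseqD[OF incseq_running_max[of z \<omega>] that] C N by (auto simp: max_def)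
      then have "\<forall>\<^sub>F n in sequentially. ?d n (x, \<omega>) = indicator U \<omega> * z x"
        by (auto simp: eventually_sequentially)
      then show ?thesis
        by (rule tendsto_eventually)
    qed simp
    then show "AE p in M \<Otimes>\<^sub>M S. (\<lambda>n. ?d n p) \<longlonglongrightarrow> indicator U (snd p) * z (fst p)"
      by (intro AE_I2) (metis prod.collapse)
  qed measurable
  have "0 \<le> (\<integral>p. indicator U (snd p) * z (fst p) \<partial>(M \<Otimes>\<^sub>M S))"
    using d_nonneg by (intro LIMSEQ_le_const[OF lim]) auto
  also have "\<dots> = (\<integral>x. \<integral>\<omega>. indicator U \<omega> * z x \<partial>S \<partial>M)"
  proof -
    have "integrable (M \<Otimes>\<^sub>M S) (\<lambda>p. indicator U (snd p) * z (fst p))"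
      by (rule Bochner_Integration.integrable_bound[OF int_z]) (auto split: split_indicator)
    from MS.integral_fst'[OF this] show ?thesis by simp
  qed
  also have "\<dots> = prob U * (\<integral>x. z x \<partial>M)"
    by simp
  finally have "prob U = 0"
    using neg measure_nonneg[of S U] by (simp add: zero_le_mult_iff)
  then have "AE \<omega> in S. \<omega> \<notin> U"
    by (subst (asm) P.prob_eq_0) auto
  with AE_space show ?thesis
  proof eventually_elim
    case (elim \<omega>)
    then obtain C :: nat where "running_max z n \<omega> \<le> real C" for n
      by (auto simp: U_def not_less)
    then show ?case
      using sum_le_running_max[of _ _ z \<omega>]
      by (intro bdd_aboveI[of _ "real C"]) (auto intro: order_trans)
  qed
qed

end

section \<open>Product densities, Kullback-Leibler divergence and exponentially small expectations\<close>

text \<open>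
  Both sides are determined by their values on boxes, where a product of one-variable integrals
  factorizes.
\<close>

lemma PiM_density:
  assumes "product_sigma_finite M" "product_sigma_finite (\<lambda>i. density (M i) (f i))" "finite I"
    and [measurable]: "\<And>i. f i \<in> borel_measurable (M i)"
  shows "(\<Pi>\<^sub>M i\<in>I. density (M i) (f i)) = density (PiM I M) (\<lambda>x. \<Prod>i\<in>I. f i (x i))"
proof (rule sym, rule product_sigma_finite.PiM_eqI[OF assms(2)])
  interpret product_sigma_finite M by fact
  show "finite I" by fact
  show "sets (density (PiM I M) (\<lambda>x. \<Prod>i\<in>I. f i (x i))) = sets (\<Pi>\<^sub>M i\<in>I. density (M i) (f i))"
    by (auto intro!: sets_PiM_cong)
  fix A assume "\<And>i. i \<in> I \<Longrightarrow> A i \<in> sets (density (M i) (f i))"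
  then have A [measurable]: "\<And>i. i \<in> I \<Longrightarrow> A i \<in> sets (M i)" by simp
  have "emeasure (density (PiM I M) (\<lambda>x. \<Prod>i\<in>I. f i (x i))) (Pi\<^sub>E I A)
      = (\<integral>\<^sup>+x. (\<Prod>i\<in>I. f i (x i)) * indicator (Pi\<^sub>E I A) x \<partial>PiM I M)"
    using \<open>finite I\<close> A by (intro emeasure_density) (auto intro!: sets_PiM_I_finite)
  also have "\<dots> = (\<integral>\<^sup>+x. (\<Prod>i\<in>I. f i (x i) * indicator (A i) (x i)) \<partial>PiM I M)"
  proof (rule nn_integral_cong)
    fix x assume "x \<in> space (PiM I M)"
    then have "indicator (Pi\<^sub>E I A) x = (\<Prod>i\<in>I. indicator (A i) (x i) :: ennreal)"
      using \<open>finite I\<close> by (auto simp: space_PiM PiE_iff indicator_def prod_zero_iff)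
    then show "(\<Prod>i\<in>I. f i (x i)) * indicator (Pi\<^sub>E I A) x
        = (\<Prod>i\<in>I. f i (x i) * indicator (A i) (x i))"
      by (simp add: prod.distrib)
  qed
  also have "\<dots> = (\<Prod>i\<in>I. \<integral>\<^sup>+y. f i y * indicator (A i) y \<partial>M i)"
    using \<open>finite I\<close> by (intro product_nn_integral_prod) auto
  also have "\<dots> = (\<Prod>i\<in>I. emeasure (density (M i) (f i)) (A i))"
    by (intro prod.cong refl emeasure_density[symmetric]) auto
  finally show "emeasure (density (PiM I M) (\<lambda>x. \<Prod>i\<in>I. f i (x i))) (Pi\<^sub>E I A)
      = (\<Prod>i\<in>I. emeasure (density (M i) (f i)) (A i))" .
qed

text \<open>
  The negative part of the integrand of \<open>K(f\<^sub>0, f)\<close> is at most \<open>f\<close>, since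
  \<open>a ln (b / a) \<le> b - a\<close>, so it always has finite integral.  If the divergence is finite, the
  positive part is therefore integrable as well; it is infinite where \<open>f\<^sub>0 > 0 = f\<close>, so this set is
  negligible, and elsewhere the extended integrand is the real one.
\<close>

lemma kl_div_less_imp:
  assumes f0: "f0 \<in> prob_densities \<mu>" and f: "f \<in> prob_densities \<mu>" and less: "kl_div \<mu> f0 f < ereal \<epsilon>"
  shows "AE x in density \<mu> f0. 0 < f0 x \<and> 0 < f x"
    and "integrable (density \<mu> f0) (\<lambda>x. ln (f0 x / f x))"
    and "(\<integral>x. ln (f0 x / f x) \<partial>density \<mu> f0) < \<epsilon>"
proof -
  have [measurable]: "f0 \<in> borel_measurable \<mu>" "f \<in> borel_measurable \<mu>"
    and nn: "\<And>x. 0 \<le> f0 x" "\<And>x. 0 \<le> f x" and f_int: "(\<integral>\<^sup>+x. ennreal (f x) \<partial>\<mu>) = 1"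
    using f0 f by (auto simp: prob_densities_def)
  define P where "P = (\<integral>\<^sup>+x. e2ennreal (kl_integrand (f0 x) (f x)) \<partial>\<mu>)"
  define Q where "Q = (\<integral>\<^sup>+x. e2ennreal (- kl_integrand (f0 x) (f x)) \<partial>\<mu>)"
  have [measurable]: "(\<lambda>x. kl_integrand (f0 x) (f x)) \<in> borel_measurable \<mu>"
    unfolding kl_integrand_def by measurable
  have "e2ennreal (- kl_integrand a b) \<le> ennreal b" if "0 \<le> a" "0 \<le> b" for a b
  proof (cases "a = 0 \<or> b = 0")
    case True
    then show ?thesis by (auto simp: kl_integrand_def e2ennreal_neg)
  next
    case False
    then have pos: "0 < a" "0 < b" using that by auto
    have "- (a * ln (a / b)) = a * ln (b / a)"
      using pos by (simp add: ln_div algebra_simps)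
    also have "\<dots> \<le> a * (b / a - 1)"
      using pos by (intro mult_left_mono ln_le_minus_one) auto
    also have "\<dots> \<le> b"
      using pos by (simp add: field_simps)
    finally have "ennreal (- (a * ln (a / b))) \<le> ennreal b" by (rule ennreal_leI)
    then show ?thesis
      using pos by (simp add: kl_integrand_def e2ennreal_ereal)
  qed
  then have "Q \<le> (\<integral>\<^sup>+x. ennreal (f x) \<partial>\<mu>)"
    unfolding Q_def using nn by (intro nn_integral_mono) auto
  then have Q: "Q < \<infinity>"
    using f_int by (auto simp: order_le_less_trans)
  have kl: "enn2ereal P - enn2ereal Q < ereal \<epsilon>"
    using less by (simp add: kl_div_def P_def Q_def)
  have P: "P < \<infinity>"
    using kl by (cases "P = \<infinity>") (auto simp: less_top)
  have "AE x in \<mu>. e2ennreal (kl_integrand (f0 x) (f x)) \<noteq> \<infinity>"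
    using P by (intro nn_integral_PInf_AE) (auto simp: P_def)
  then have pos: "AE x in \<mu>. f0 x \<noteq> 0 \<longrightarrow> f x \<noteq> 0"
    by eventually_elim (auto simp: kl_integrand_def)
  then show "AE x in density \<mu> f0. 0 < f0 x \<and> 0 < f x"
    using nn by (subst AE_density) (auto simp: less_le)
  define g where "g = (\<lambda>x. f0 x * ln (f0 x / f x))"
  have [measurable]: "g \<in> borel_measurable \<mu>"
    unfolding g_def by measurable
  have gP: "(\<integral>\<^sup>+x. ennreal (g x) \<partial>\<mu>) = P"
    unfolding P_def using pos
    by (intro nn_integral_cong_AE, eventually_elim) (auto simp: kl_integrand_def g_def e2ennreal_ereal)
  have gQ: "(\<integral>\<^sup>+x. ennreal (- g x) \<partial>\<mu>) = Q"
    unfolding Q_def using pos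
    by (intro nn_integral_cong_AE, eventually_elim) (auto simp: kl_integrand_def g_def e2ennreal_ereal)
  have g_int: "integrable \<mu> g"
    using P Q by (simp add: real_integrable_def gP gQ less_top[symmetric])
  then show "integrable (density \<mu> f0) (\<lambda>x. ln (f0 x / f x))"
    using nn by (subst integrable_density) (auto simp: g_def)
  have "(\<integral>x. ln (f0 x / f x) \<partial>density \<mu> f0) = (\<integral>x. g x \<partial>\<mu>)"
    using nn by (subst integral_density) (auto simp: g_def)
  also have "\<dots> = enn2real P - enn2real Q"
    using g_int by (simp add: real_lebesgue_integral_def gP gQ)
  also have "\<dots> < \<epsilon>"
    using kl P Q by (cases P; cases Q) auto
  finally show "(\<integral>x. ln (f0 x / f x) \<partial>density \<mu> f0) < \<epsilon>" .
qed

text \<open>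
  The bound \<open>R\<^sup>\<alpha> \<le> 1 + R\<close> is enough to control a moment of order \<open>\<alpha> \<le> 1\<close> by an expectation; it takes
  the place of the Jensen inequality and covers infinite values.
\<close>

lemma ennreal_powr_le:
  assumes "Y \<le> ennreal c * R" "0 < c" "0 < \<alpha>" "\<alpha> \<le> 1"
  shows "ennreal_powr Y \<alpha> \<le> ennreal (c powr \<alpha>) * (1 + R)"
proof (cases R)
  case (real r)
  from assms(1) have "Y \<le> ennreal (c * r)"
    using real assms by (simp add: ennreal_mult)
  then obtain y where y: "Y = ennreal y" "0 \<le> y" "y \<le> c * r"
    using real assms by (cases Y) (auto simp: ennreal_le_iff top_unique)
  have "r powr \<alpha> \<le> 1 + r"
  proof (cases "r \<le> 1")
    case True
    then have "r powr \<alpha> \<le> 1 powr \<alpha>" using real assms by (intro powr_mono2) auto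
    with real show ?thesis by simp
  next
    case False
    then have "r powr \<alpha> \<le> r powr 1" using assms by (intro powr_mono) auto
    with False show ?thesis by simp
  qed
  have "y powr \<alpha> \<le> (c * r) powr \<alpha>"
    using y assms by (intro powr_mono2) auto
  also have "\<dots> = c powr \<alpha> * r powr \<alpha>"
    using real assms by (simp add: powr_mult)
  also have "\<dots> \<le> c powr \<alpha> * (1 + r)"
    using \<open>r powr \<alpha> \<le> 1 + r\<close> by (intro mult_left_mono) auto
  finally have "ennreal (y powr \<alpha>) \<le> ennreal (c powr \<alpha> * (1 + r))"
    by (rule ennreal_leI)
  then show ?thesis
    using y real by (simp add: ennreal_powr_def ennreal_mult)
next
  case top
  then show ?thesis using assms by (simp add: ennreal_mult_top)
qed

lemma ennreal_powr_1 [simp]: "ennreal_powr x 1 = x"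
  by (cases x) (auto simp: ennreal_powr_def)

lemma borel_measurable_ennreal_powr [measurable]: "(\<lambda>x. ennreal_powr x \<alpha>) \<in> borel_measurable borel"
  unfolding ennreal_powr_def by measurable

lemma le_of_ennreal_powr_le:
  assumes "ennreal_powr Y \<alpha> \<le> ennreal c" "0 < \<alpha>" "0 \<le> c"
  shows "Y \<le> ennreal (c powr (1 / \<alpha>))"
proof (cases Y)
  case (real y)
  then have "y powr \<alpha> \<le> c"
    using assms by (simp add: ennreal_powr_def)
  then have "(y powr \<alpha>) powr (1 / \<alpha>) \<le> c powr (1 / \<alpha>)"
    using assms by (intro powr_mono2) auto
  then show ?thesis
    using real assms by (simp add: powr_powr ennreal_leI)
qed (use assms in \<open>simp add: ennreal_powr_def top_unique\<close>)

text \<open>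
  The Markov inequality makes the probabilities of \<open>W\<^sub>n > exp (- n \<gamma>)\<close> geometrically small, and
  Borel-Cantelli applies.
\<close>

lemma (in prob_space) AE_eventually_le_exp:
  fixes W :: "nat \<Rightarrow> 'a \<Rightarrow> ennreal"
  assumes [measurable]: "\<And>n. W n \<in> borel_measurable M"
    and W: "\<forall>\<^sub>F n in sequentially. (\<integral>\<^sup>+\<omega>. W n \<omega> \<partial>M) \<le> ennreal (exp (- real n * \<beta>))"
    and "\<gamma> < \<beta>"
  shows "AE \<omega> in M. \<forall>\<^sub>F n in sequentially. W n \<omega> \<le> ennreal (exp (- real n * \<gamma>))"
proof -
  define B where "B n = {\<omega> \<in> space M. 1 \<le> ennreal (exp (real n * \<gamma>)) * W n \<omega>}" for n
  have [measurable]: "B n \<in> sets M" for n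
    unfolding B_def by measurable
  have "\<forall>\<^sub>F n in sequentially. norm (prob (B n)) \<le> exp (- (\<beta> - \<gamma>)) ^ n"
    using W
  proof eventually_elim
    case (elim n)
    have "emeasure M (B n) \<le> ennreal (exp (real n * \<gamma>)) * (\<integral>\<^sup>+\<omega>. W n \<omega> * indicator (space M) \<omega> \<partial>M)"
      unfolding B_def by (rule nn_integral_Markov_inequality) auto
    also have "(\<integral>\<^sup>+\<omega>. W n \<omega> * indicator (space M) \<omega> \<partial>M) = (\<integral>\<^sup>+\<omega>. W n \<omega> \<partial>M)"
      by (rule nn_integral_cong) auto
    also have "ennreal (exp (real n * \<gamma>)) * \<dots>
        \<le> ennreal (exp (real n * \<gamma>)) * ennreal (exp (- real n * \<beta>))"
      by (intro mult_left_mono elim) auto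
    also have "\<dots> = ennreal (exp (- (\<beta> - \<gamma>)) ^ n)"
      by (simp add: ennreal_mult[symmetric] exp_add[symmetric] exp_of_nat_mult[symmetric] algebra_simps)
    finally show ?case
      by (simp add: emeasure_eq_measure)
  qed
  then have "summable (\<lambda>n. prob (B n))"
    by (rule summable_comparison_test_ev) (use \<open>\<gamma> < \<beta>\<close> in \<open>auto intro!: summable_geometric\<close>)
  then have "AE \<omega> in M. \<forall>\<^sub>F n in sequentially. \<omega> \<in> space M - B n"
    by (intro borel_cantelli_AE1) (auto simp: emeasure_eq_measure)
  then show ?thesis
  proof eventually_elim
    case (elim \<omega>)
    then show ?case
    proof eventually_elim
      case (elim n)
      then have "ennreal (exp (real n * \<gamma>)) * W n \<omega> \<le> 1"
        by (auto simp: B_def)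
      then have "ennreal (exp (- real n * \<gamma>)) * (ennreal (exp (real n * \<gamma>)) * W n \<omega>)
          \<le> ennreal (exp (- real n * \<gamma>)) * 1"
        by (intro mult_left_mono) auto
      then show ?case
        by (simp add: mult.assoc[symmetric] ennreal_mult[symmetric] exp_add[symmetric])
    qed
  qed
qed

section \<open>Priors on densities and likelihood ratios\<close>

text \<open>
  Evaluation is measurable with respect to the sigma-algebra of the prior itself; for a prior on
  the Hellinger-Borel sets this is the joint measurability of the versions.
\<close>

locale density_model = mu: sigma_finite_measure \<mu> + prior: prob_space prior
  for \<mu> :: "'a measure" and F :: "('a \<Rightarrow> real) set" and prior :: "('a \<Rightarrow> real) measure" and f0 +
  assumes space_mu: "space \<mu> = UNIV"
    and F: "F \<subseteq> prob_densities \<mu>"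
    and space_prior: "space prior = F"
    and eval: "(\<lambda>(x, f). f x) \<in> borel_measurable (\<mu> \<Otimes>\<^sub>M prior)"
    and f0: "f0 \<in> prob_densities \<mu>"
begin

lemma density_nonneg: "f \<in> prob_densities \<mu> \<Longrightarrow> 0 \<le> f x"
  by (auto simp: prob_densities_def)

lemma prob_space_density: "f \<in> prob_densities \<mu> \<Longrightarrow> prob_space (density \<mu> (\<lambda>x. ennreal (f x)))"
  by (rule prob_spaceI) (auto simp: emeasure_density prob_densities_def intro!: nn_integral_cong)

lemma sets_iid_law [measurable_cong, simp]: "sets (iid_law \<mu> f) = sets (\<Pi>\<^sub>M i\<in>UNIV. \<mu>)"
  unfolding iid_law_def by (rule sets_PiM_cong) auto

lemma space_iid_law [simp]: "space (iid_law \<mu> f) = UNIV"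
  by (simp add: iid_law_def space_PiM space_mu)

lemma space_sample_space: "space (sample_space \<mu> n) = {..<n} \<rightarrow>\<^sub>E UNIV"
  by (simp add: space_PiM space_mu)

lemma prob_space_iid_law: "f \<in> prob_densities \<mu> \<Longrightarrow> prob_space (iid_law \<mu> f)"
  unfolding iid_law_def by (intro prob_space_PiM prob_space_density)

text \<open>
  The first \<open>n\<close> observations have joint density \<open>\<Prod>i<n. f (x i)\<close>.  Through this formula the laws for
  different \<open>f\<close> are compared: all have a density with respect to the same measure on samples.
\<close>

lemma nn_integral_iid_law:
  assumes f: "f \<in> prob_densities \<mu>" and [measurable]: "g \<in> borel_measurable (sample_space \<mu> n)"
  shows "(\<integral>\<^sup>+\<omega>. g (restrict \<omega> {..<n}) \<partial>iid_law \<mu> f)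
    = (\<integral>\<^sup>+x. ennreal (\<Prod>i<n. f (x i)) * g x \<partial>sample_space \<mu> n)"
proof -
  have [measurable]: "f \<in> borel_measurable \<mu>"
    using f by (simp add: prob_densities_def)
  interpret D: prob_space "density \<mu> (\<lambda>x. ennreal (f x))"
    using f by (rule prob_space_density)
  interpret D: product_prob_space "\<lambda>_::nat. density \<mu> (\<lambda>x. ennreal (f x))" UNIV ..
  have "product_sigma_finite (\<lambda>_::nat. \<mu>)" ..
  then have fin: "(\<Pi>\<^sub>M i\<in>{..<n}. density \<mu> (\<lambda>x. ennreal (f x)))
      = density (sample_space \<mu> n) (\<lambda>x. \<Prod>i<n. ennreal (f (x i)))"
    using D.product_sigma_finite_axioms by (rule PiM_density) auto
  have "distr (iid_law \<mu> f) (\<Pi>\<^sub>M i\<in>{..<n}. density \<mu> (\<lambda>x. ennreal (f x))) (\<lambda>\<omega>. restrict \<omega> {..<n})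
      = (\<Pi>\<^sub>M i\<in>{..<n}. density \<mu> (\<lambda>x. ennreal (f x)))"
    unfolding iid_law_def by (rule D.distr_PiM_restrict_finite) auto
  also have "distr (iid_law \<mu> f) (\<Pi>\<^sub>M i\<in>{..<n}. density \<mu> (\<lambda>x. ennreal (f x))) (\<lambda>\<omega>. restrict \<omega> {..<n})
      = distr (iid_law \<mu> f) (sample_space \<mu> n) (\<lambda>\<omega>. restrict \<omega> {..<n})"
    by (rule distr_cong) (auto intro!: sets_PiM_cong)
  finally have d: "distr (iid_law \<mu> f) (sample_space \<mu> n) (\<lambda>\<omega>. restrict \<omega> {..<n})
      = density (sample_space \<mu> n) (\<lambda>x. \<Prod>i<n. ennreal (f (x i)))"
    unfolding fin .
  have "(\<integral>\<^sup>+\<omega>. g (restrict \<omega> {..<n}) \<partial>iid_law \<mu> f)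
      = (\<integral>\<^sup>+x. g x \<partial>distr (iid_law \<mu> f) (sample_space \<mu> n) (\<lambda>\<omega>. restrict \<omega> {..<n}))"
    by (rule nn_integral_distr[symmetric]) measurable
  also have "\<dots> = (\<integral>\<^sup>+x. (\<Prod>i<n. ennreal (f (x i))) * g x \<partial>sample_space \<mu> n)"
    unfolding d by (rule nn_integral_density) measurable
  finally show ?thesis
    using density_nonneg[OF f] by (simp add: prod_ennreal)
qed

definition avg_likelihood :: "nat \<Rightarrow> ('a \<Rightarrow> real) set \<Rightarrow> (nat \<Rightarrow> 'a) \<Rightarrow> ennreal" where
  "avg_likelihood n A \<omega> = (\<integral>\<^sup>+f\<in>A. ennreal (\<Prod>i<n. f (\<omega> i)) \<partial>prior)"

definition avg_ratio :: "nat \<Rightarrow> ('a \<Rightarrow> real) set \<Rightarrow> (nat \<Rightarrow> 'a) \<Rightarrow> ennreal" where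
  "avg_ratio n A \<omega> = (\<integral>\<^sup>+f\<in>A. ennreal (likelihood_ratio f0 n \<omega> f) \<partial>prior)"

lemma measurable_f0 [measurable]: "f0 \<in> borel_measurable \<mu>"
  using f0 by (simp add: prob_densities_def)

text \<open>
  The sample is a function \<open>X\<close> of an arbitrary parameter so that the same lemma serves infinite
  paths, finite samples and, with a trivial parameter space, a fixed path.
\<close>

lemma measurable_likelihood:
  assumes [measurable]: "\<And>i. i < n \<Longrightarrow> (\<lambda>w. X w i) \<in> N \<rightarrow>\<^sub>M \<mu>"
  shows "(\<lambda>(w, f). \<Prod>i<n. f (X w i)) \<in> borel_measurable (N \<Otimes>\<^sub>M prior)"
proof -
  have "(\<lambda>p. (snd p) (X (fst p) i)) \<in> borel_measurable (N \<Otimes>\<^sub>M prior)" if "i < n" for i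
  proof -
    note [measurable] = assms[OF that]
    have "(\<lambda>p. (X (fst p) i, snd p)) \<in> N \<Otimes>\<^sub>M prior \<rightarrow>\<^sub>M \<mu> \<Otimes>\<^sub>M prior"
      by measurable
    from measurable_compose[OF this eval] show ?thesis
      by simp
  qed
  then show ?thesis
    unfolding case_prod_beta' by (intro borel_measurable_prod) auto
qed

lemma likelihood_ratio_eq:
  "likelihood_ratio f0 n \<omega> f = (\<Prod>i<n. f (\<omega> i)) * inverse (\<Prod>i<n. f0 (\<omega> i))"
  by (simp add: likelihood_ratio_def prod_dividef divide_inverse[of "prod _ _"])

lemma measurable_likelihood_ratio:
  assumes [measurable]: "\<And>i. i < n \<Longrightarrow> (\<lambda>w. X w i) \<in> N \<rightarrow>\<^sub>M \<mu>"
  shows "(\<lambda>(w, f). likelihood_ratio f0 n (X w) f) \<in> borel_measurable (N \<Otimes>\<^sub>M prior)"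
proof -
  note [measurable] = measurable_likelihood[OF assms]
  show ?thesis
    unfolding likelihood_ratio_eq by measurable
qed

lemma measurable_avg_likelihood:
  assumes "\<And>i. i < n \<Longrightarrow> (\<lambda>w. X w i) \<in> N \<rightarrow>\<^sub>M \<mu>" and [measurable]: "A \<in> sets prior"
  shows "(\<lambda>w. avg_likelihood n A (X w)) \<in> borel_measurable N"
proof -
  note [measurable] = measurable_likelihood[OF assms(1)]
  show ?thesis unfolding avg_likelihood_def by measurable
qed

text \<open>
  The true likelihood is constant in \<open>f\<close>.  With \<open>inverse 0 = 0\<close> the identity also holds for samples
  of true likelihood zero, so no exceptional set arises.
\<close>

lemma avg_ratio_eq: "avg_ratio n A \<omega> = avg_likelihood n A \<omega> * ennreal (inverse (\<Prod>i<n. f0 (\<omega> i)))"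
  if [measurable]: "A \<in> sets prior" and \<omega>: "\<And>i. i < n \<Longrightarrow> \<omega> i \<in> space \<mu>"
proof -
  have "(\<lambda>(w, f). \<Prod>i<n. f (\<omega> i)) \<in> borel_measurable (count_space {()} \<Otimes>\<^sub>M prior)"
    using \<omega> by (intro measurable_likelihood) auto
  from measurable_compose_Pair1[OF _ this]
  have [measurable]: "(\<lambda>f. \<Prod>i<n. f (\<omega> i)) \<in> borel_measurable prior" by simp
  have nn: "0 \<le> inverse (\<Prod>i<n. f0 (\<omega> i))"
    using density_nonneg[OF f0] by (auto intro!: prod_nonneg)
  have "avg_ratio n A \<omega> = (\<integral>\<^sup>+f. (ennreal (\<Prod>i<n. f (\<omega> i)) * indicator A f) * ennreal (inverse (\<Prod>i<n. f0 (\<omega> i))) \<partial>prior)"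
    unfolding avg_ratio_def likelihood_ratio_eq
    using nn by (intro nn_integral_cong) (simp add: ennreal_mult'' ac_simps)
  then show ?thesis
    by (simp add: nn_integral_multc avg_likelihood_def)
qed

lemma measurable_avg_ratio:
  assumes "\<And>i. i < n \<Longrightarrow> (\<lambda>w. X w i) \<in> N \<rightarrow>\<^sub>M \<mu>" and [measurable]: "A \<in> sets prior"
  shows "(\<lambda>w. avg_ratio n A (X w)) \<in> borel_measurable N"
proof -
  note [measurable] = measurable_likelihood_ratio[OF assms(1)]
  show ?thesis unfolding avg_ratio_def by measurable
qed

lemma measurable_avg_ratio_iid_law [measurable]:
  "A \<in> sets prior \<Longrightarrow> avg_ratio n A \<in> borel_measurable (\<Pi>\<^sub>M i\<in>UNIV. \<mu>)"
  by (rule measurable_avg_ratio) measurable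

lemma posterior_eq: "posterior prior n \<omega> A = avg_likelihood n A \<omega> / avg_likelihood n F \<omega>"
  unfolding posterior_def avg_likelihood_def
  by (intro arg_cong2[where f="(/)"] refl nn_integral_cong) (simp add: space_prior)

lemma F_sets [measurable]: "F \<in> sets prior"
  using sets.top[of prior] by (simp add: space_prior)

lemma measurable_posterior:
  assumes "\<And>i. i < n \<Longrightarrow> (\<lambda>w. X w i) \<in> N \<rightarrow>\<^sub>M \<mu>" and "A \<in> sets prior"
  shows "(\<lambda>w. posterior prior n (X w) A) \<in> borel_measurable N"
proof -
  note [measurable] = measurable_avg_likelihood[OF assms] measurable_avg_likelihood[OF assms(1) F_sets]
  show ?thesis unfolding posterior_eq by measurable
qed

lemma measurable_posterior_iid_law [measurable]:
  "A \<in> sets prior \<Longrightarrow> (\<lambda>\<omega>. posterior prior n \<omega> A) \<in> borel_measurable (\<Pi>\<^sub>M i\<in>UNIV. \<mu>)"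
  by (rule measurable_posterior) measurable

lemma posterior_restrict: "posterior prior n (restrict \<omega> {..<n}) A = posterior prior n \<omega> A"
  unfolding posterior_def by (simp cong: prod.cong_simp)

text \<open>
  Clearing the denominator of the posterior is legitimate even if it is degenerate: when it is \<open>0\<close>
  so is the numerator, and when it is \<open>\<infinity>\<close> then so is its product with \<open>c > 0\<close>.  Multiplying by the
  inverse of the true likelihood turns the likelihoods into ratios.
\<close>

lemma avg_ratio_le_of_posterior_le:
  assumes A: "A \<in> sets prior" and le_c: "posterior prior n \<omega> A \<le> ennreal c" and "0 < c"
  shows "avg_ratio n A \<omega> \<le> ennreal c * avg_ratio n F \<omega>"
proof -
  have le: "avg_likelihood n A \<omega> \<le> avg_likelihood n F \<omega>"
    using sets.sets_into_space[OF A] unfolding avg_likelihood_def space_prior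
    by (intro nn_integral_mono mult_left_mono) (auto simp: indicator_def)
  have "avg_likelihood n A \<omega> \<le> ennreal c * avg_likelihood n F \<omega>"
  proof (cases "avg_likelihood n F \<omega> = 0 \<or> avg_likelihood n F \<omega> = \<top>")
    case True
    with le \<open>0 < c\<close> show ?thesis by (auto simp: ennreal_mult_top)
  next
    case False
    then have "avg_likelihood n A \<omega> = posterior prior n \<omega> A * avg_likelihood n F \<omega>"
      by (simp add: posterior_eq ennreal_divide_times less_top[symmetric])
    also have "\<dots> \<le> ennreal c * avg_likelihood n F \<omega>"
      using le_c by (rule mult_right_mono) simp
    finally show ?thesis .
  qed
  then have "avg_likelihood n A \<omega> * ennreal (inverse (\<Prod>i<n. f0 (\<omega> i)))
      \<le> ennreal c * avg_likelihood n F \<omega> * ennreal (inverse (\<Prod>i<n. f0 (\<omega> i)))"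
    by (rule mult_right_mono) simp
  then show ?thesis
    using A by (simp add: avg_ratio_eq space_mu mult.assoc)
qed

text \<open>
  Numerator and denominator of the posterior are the averaged ratios multiplied by the true
  likelihood, which is positive and finite here and cancels.
\<close>

lemma posterior_le_of_avg_ratio:
  assumes A: "A \<in> sets prior" and pos: "\<And>i. i < n \<Longrightarrow> 0 < f0 (\<omega> i)"
    and le: "avg_ratio n A \<omega> \<le> ennreal a" "ennreal b \<le> avg_ratio n F \<omega>" and "0 \<le> a" "0 < b"
  shows "posterior prior n \<omega> A \<le> ennreal (a / b)"
proof -
  let ?p = "\<Prod>i<n. f0 (\<omega> i)"
  have p: "0 < ?p" using pos by (intro prod_pos) auto
  have "ennreal (inverse ?p) * ennreal ?p = 1"
  proof -
    have "inverse ?p * ?p = 1"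
      using p by (metis left_inverse less_irrefl)
    then show ?thesis
      using p by (subst ennreal_mult[symmetric]) (auto simp del: prod_inversef)
  qed
  then have lik: "avg_likelihood n A' \<omega> = avg_ratio n A' \<omega> * ennreal ?p" if "A' \<in> sets prior" for A'
    using that by (simp add: avg_ratio_eq space_mu mult.assoc del: prod_inversef)
  have lower: "ennreal (b * ?p) \<le> avg_likelihood n F \<omega>"
    using le(2) p \<open>0 < b\<close> by (simp add: lik ennreal_mult mult_right_mono)
  show ?thesis
    unfolding posterior_eq
  proof (rule divide_le_posI_ennreal)
    show "0 < avg_likelihood n F \<omega>"
      using lower p \<open>0 < b\<close> by (auto intro: less_le_trans[rotated])
    have "avg_likelihood n A \<omega> \<le> ennreal a * ennreal ?p"
      using le(1) A by (simp add: lik mult_right_mono)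
    also have "\<dots> = ennreal (b * ?p) * ennreal (a / b)"
      using p \<open>0 \<le> a\<close> \<open>0 < b\<close> by (simp add: ennreal_mult[symmetric])
    also have "\<dots> \<le> avg_likelihood n F \<omega> * ennreal (a / b)"
      using lower by (rule mult_right_mono) simp
    finally show "avg_likelihood n A \<omega> \<le> avg_likelihood n F \<omega> * ennreal (a / b)" .
  qed
qed

lemma measurable_cylinder [measurable]:
  assumes [measurable]: "E \<in> sets (sample_space \<mu> n)"
  shows "cylinder n E \<in> sets (\<Pi>\<^sub>M i\<in>UNIV. \<mu>)"
proof -
  have "(\<lambda>\<omega>. restrict \<omega> {..<n}) -` E \<inter> space (\<Pi>\<^sub>M i\<in>UNIV. \<mu>) \<in> sets (\<Pi>\<^sub>M i\<in>UNIV. \<mu>)"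
    by measurable
  then show ?thesis
    by (simp add: cylinder_def vimage_def space_PiM space_mu)
qed

definition support_samples :: "nat \<Rightarrow> (nat \<Rightarrow> 'a) set" where
  "support_samples n = {x \<in> space (sample_space \<mu> n). 0 < (\<Prod>i<n. f0 (x i))}"

lemma sets_support_samples [measurable]: "support_samples n \<in> sets (sample_space \<mu> n)"
  unfolding support_samples_def by measurable

lemma emeasure_iid_law_cylinder:
  assumes f: "f \<in> prob_densities \<mu>" and [measurable]: "E \<in> sets (sample_space \<mu> n)"
  shows "emeasure (iid_law \<mu> f) (cylinder n E)
    = (\<integral>\<^sup>+x. ennreal (\<Prod>i<n. f (x i)) * indicator E x \<partial>sample_space \<mu> n)"
proof -
  have "emeasure (iid_law \<mu> f) (cylinder n E) = (\<integral>\<^sup>+\<omega>. indicator (cylinder n E) \<omega> \<partial>iid_law \<mu> f)"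
    by simp
  also have "\<dots> = (\<integral>\<^sup>+\<omega>. indicator E (restrict \<omega> {..<n}) \<partial>iid_law \<mu> f)"
    by (rule nn_integral_cong) (simp add: cylinder_def indicator_def)
  finally show ?thesis
    using nn_integral_iid_law[OF f, of "indicator E" n] by simp
qed

text \<open>
  Multiplying \<open>R\<^sub>n(f)\<close> by the true likelihood gives back the likelihood of \<open>f\<close>, except on samples of
  true likelihood zero, where the product vanishes; hence the restriction to \<open>support_samples\<close>.
\<close>

lemma nn_integral_likelihood_ratio:
  assumes f: "f \<in> F" and [measurable]: "E \<in> sets (sample_space \<mu> n)"
  shows "(\<integral>\<^sup>+\<omega>. indicator (cylinder n E) \<omega> * ennreal (likelihood_ratio f0 n \<omega> f) \<partial>iid_law \<mu> f0)
    = emeasure (iid_law \<mu> f) (cylinder n (E \<inter> support_samples n))"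
proof -
  have fd: "f \<in> prob_densities \<mu>" using f F by auto
  then have [measurable]: "f \<in> borel_measurable \<mu>" by (simp add: prob_densities_def)
  let ?g = "\<lambda>x. indicator E x * ennreal (likelihood_ratio f0 n x f)"
  have [measurable]: "?g \<in> borel_measurable (sample_space \<mu> n)"
    unfolding likelihood_ratio_def by measurable
  have "(\<integral>\<^sup>+\<omega>. indicator (cylinder n E) \<omega> * ennreal (likelihood_ratio f0 n \<omega> f) \<partial>iid_law \<mu> f0)
      = (\<integral>\<^sup>+\<omega>. ?g (restrict \<omega> {..<n}) \<partial>iid_law \<mu> f0)"
    by (rule nn_integral_cong)
      (simp add: cylinder_def indicator_def likelihood_ratio_def cong: prod.cong_simp)
  also have "\<dots> = (\<integral>\<^sup>+x. ennreal (\<Prod>i<n. f0 (x i)) * ?g x \<partial>sample_space \<mu> n)"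
    by (rule nn_integral_iid_law[OF f0]) measurable
  also have "\<dots> = (\<integral>\<^sup>+x. ennreal (\<Prod>i<n. f (x i)) * indicator (E \<inter> support_samples n) x \<partial>sample_space \<mu> n)"
  proof (rule nn_integral_cong)
    fix x assume x: "x \<in> space (sample_space \<mu> n)"
    let ?p = "\<Prod>i<n. f0 (x i)" and ?q = "\<Prod>i<n. f (x i)"
    have p: "0 \<le> ?p" and q: "0 \<le> ?q"
      using density_nonneg[OF f0] density_nonneg[OF fd] by (auto intro!: prod_nonneg)
    show "ennreal ?p * ?g x = ennreal ?q * indicator (E \<inter> support_samples n) x"
    proof (cases "?p = 0")
      case True
      then have "x \<notin> support_samples n" unfolding support_samples_def by (simp del: prod_zero_iff)
      with True show ?thesis by (simp del: prod_zero_iff)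
    next
      case False
      with p have "0 < ?p" by (metis order_le_less)
      then have "x \<in> support_samples n" using x by (simp add: support_samples_def)
      moreover have "ennreal ?p * ennreal (likelihood_ratio f0 n x f) = ennreal ?q"
      proof -
        have "?p * likelihood_ratio f0 n x f = ?q"
          using False by (simp add: likelihood_ratio_eq field_simps del: prod_inversef prod_zero_iff)
        then show ?thesis
          using p q by (metis ennreal_mult')
      qed
      ultimately show ?thesis
        by (auto simp: indicator_def)
    qed
  qed
  also have "\<dots> = emeasure (iid_law \<mu> f) (cylinder n (E \<inter> support_samples n))"
    by (rule emeasure_iid_law_cylinder[OF fd, symmetric]) measurable
  finally show ?thesis .
qed

lemma nn_integral_avg_ratio:
  assumes [measurable]: "A \<in> sets prior" "E \<in> sets (sample_space \<mu> n)"
  shows "(\<integral>\<^sup>+\<omega>. indicator (cylinder n E) \<omega> * avg_ratio n A \<omega> \<partial>iid_law \<mu> f0)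
    = (\<integral>\<^sup>+f\<in>A. emeasure (iid_law \<mu> f) (cylinder n (E \<inter> support_samples n)) \<partial>prior)"
proof -
  interpret P0: prob_space "iid_law \<mu> f0"
    using f0 by (rule prob_space_iid_law)
  interpret pair_sigma_finite "iid_law \<mu> f0" prior ..
  have [measurable]: "(\<lambda>(\<omega>, f). likelihood_ratio f0 n \<omega> f) \<in> borel_measurable (iid_law \<mu> f0 \<Otimes>\<^sub>M prior)"
    by (rule measurable_likelihood_ratio) measurable
  have [measurable]: "likelihood_ratio f0 n \<omega> \<in> borel_measurable prior" for \<omega>
    using measurable_compose_Pair1[of \<omega> "iid_law \<mu> f0" "\<lambda>(\<omega>, f). likelihood_ratio f0 n \<omega> f" prior borel]
    by simp
  have "(\<integral>\<^sup>+\<omega>. indicator (cylinder n E) \<omega> * avg_ratio n A \<omega> \<partial>iid_law \<mu> f0)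
      = (\<integral>\<^sup>+\<omega>. \<integral>\<^sup>+f. indicator A f * (indicator (cylinder n E) \<omega> * ennreal (likelihood_ratio f0 n \<omega> f)) \<partial>prior \<partial>iid_law \<mu> f0)"
    unfolding avg_ratio_def by (simp add: nn_integral_cmult[symmetric] ac_simps)
  also have "\<dots> = (\<integral>\<^sup>+f. \<integral>\<^sup>+\<omega>. indicator A f * (indicator (cylinder n E) \<omega> * ennreal (likelihood_ratio f0 n \<omega> f)) \<partial>iid_law \<mu> f0 \<partial>prior)"
    by (rule Fubini'[symmetric]) measurable
  also have "\<dots> = (\<integral>\<^sup>+f\<in>A. emeasure (iid_law \<mu> f) (cylinder n (E \<inter> support_samples n)) \<partial>prior)"
  proof (rule nn_integral_cong)
    fix f assume "f \<in> space prior"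
    then have f: "f \<in> F" by (simp add: space_prior)
    then have [measurable]: "f \<in> borel_measurable \<mu>" using F by (auto simp: prob_densities_def)
    have [measurable]: "(\<lambda>\<omega>. likelihood_ratio f0 n \<omega> f) \<in> borel_measurable (iid_law \<mu> f0)"
      unfolding likelihood_ratio_def by measurable
    have "(\<integral>\<^sup>+\<omega>. indicator A f * (indicator (cylinder n E) \<omega> * ennreal (likelihood_ratio f0 n \<omega> f)) \<partial>iid_law \<mu> f0)
        = indicator A f * (\<integral>\<^sup>+\<omega>. indicator (cylinder n E) \<omega> * ennreal (likelihood_ratio f0 n \<omega> f) \<partial>iid_law \<mu> f0)"
      by (rule nn_integral_cmult) measurable
    then show "(\<integral>\<^sup>+\<omega>. indicator A f * (indicator (cylinder n E) \<omega> * ennreal (likelihood_ratio f0 n \<omega> f)) \<partial>iid_law \<mu> f0)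
        = emeasure (iid_law \<mu> f) (cylinder n (E \<inter> support_samples n)) * indicator A f"
      using nn_integral_likelihood_ratio[OF f assms(2)] by (simp add: ac_simps)
  qed
  finally show ?thesis .
qed

lemma nn_integral_avg_ratio_le_1:
  "(\<integral>\<^sup>+\<omega>. avg_ratio n F \<omega> \<partial>iid_law \<mu> f0) \<le> 1"
proof -
  have "(\<integral>\<^sup>+\<omega>. avg_ratio n F \<omega> \<partial>iid_law \<mu> f0)
      = (\<integral>\<^sup>+\<omega>. indicator (cylinder n (space (sample_space \<mu> n))) \<omega> * avg_ratio n F \<omega> \<partial>iid_law \<mu> f0)"
    by (rule nn_integral_cong) (simp add: cylinder_def space_sample_space)
  also have "\<dots> = (\<integral>\<^sup>+f\<in>F. emeasure (iid_law \<mu> f) (cylinder n (space (sample_space \<mu> n) \<inter> support_samples n)) \<partial>prior)"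
    by (rule nn_integral_avg_ratio) auto
  also have "\<dots> \<le> (\<integral>\<^sup>+f. 1 \<partial>prior)"
  proof (rule nn_integral_mono)
    fix f assume "f \<in> space prior"
    then interpret prob_space "iid_law \<mu> f"
      using F by (intro prob_space_iid_law) (auto simp: space_prior)
    show "emeasure (iid_law \<mu> f) (cylinder n (space (sample_space \<mu> n) \<inter> support_samples n)) * indicator F f \<le> 1"
      using emeasure_le_1 by (auto simp: indicator_def)
  qed
  finally show ?thesis
    by (simp add: prior.emeasure_space_1)
qed

lemma AE_f0_pos: "AE \<omega> in iid_law \<mu> f0. \<forall>i. 0 < f0 (\<omega> i)"
proof -
  have "AE x in density \<mu> f0. 0 < f0 x"
    by (subst AE_density) auto
  then have "AE \<omega> in iid_law \<mu> f0. 0 < f0 (\<omega> i)" for i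
    unfolding iid_law_def using prob_space_density[OF f0] by (intro AE_PiM_component) auto
  then show ?thesis
    by (simp add: AE_all_countable)
qed

text \<open>
  The lower bound holds for all \<open>n\<close> at once, with a random constant: \<open>c\<close> is the prior integral, over
  the densities within divergence \<open>\<epsilon>\<close>, of the infimum \<open>h\<close> of \<open>exp (n \<epsilon>) R\<^sub>n(f)\<close> over \<open>n\<close>.  That
  infimum is positive because \<open>- ln (exp (n \<epsilon>) R\<^sub>n(f))\<close> is a partial sum of independent variables
  with mean \<open>K(f\<^sub>0, f) - \<epsilon> < 0\<close>.
\<close>

lemma AE_avg_ratio_lower_bound:
  assumes kl: "kl_support \<mu> prior f0" and "0 < \<epsilon>"
  shows "AE \<omega> in iid_law \<mu> f0. \<exists>c>0. \<forall>n. ennreal (c * exp (- real n * \<epsilon>)) \<le> avg_ratio n F \<omega>"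
proof -
  define B where "B = {f \<in> space prior. kl_div \<mu> f0 f < ereal \<epsilon>}"
  have B_pos: "emeasure prior B > 0"
    using kl \<open>0 < \<epsilon>\<close> by (simp add: kl_support_def B_def)
  then have B [measurable]: "B \<in> sets prior"
    using emeasure_notin_sets by force
  define h where "h \<omega> f = (INF n. ennreal (exp (real n * \<epsilon>) * likelihood_ratio f0 n \<omega> f))" for \<omega> f
  have [measurable]: "(\<lambda>(\<omega>, f). likelihood_ratio f0 n \<omega> f) \<in> borel_measurable (iid_law \<mu> f0 \<Otimes>\<^sub>M prior)" for n
    by (rule measurable_likelihood_ratio) measurable
  have h_meas [measurable]: "(\<lambda>(\<omega>, f). h \<omega> f) \<in> borel_measurable (iid_law \<mu> f0 \<Otimes>\<^sub>M prior)"
    unfolding h_def by measurable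
  interpret D0: prob_space "density \<mu> (\<lambda>x. ennreal (f0 x))"
    using f0 by (rule prob_space_density)
  interpret D: sequence_space "density \<mu> (\<lambda>x. ennreal (f0 x))" ..
  interpret P0: prob_space "iid_law \<mu> f0"
    using f0 by (rule prob_space_iid_law)
  interpret pair_sigma_finite "iid_law \<mu> f0" prior ..
  have h_pos: "AE \<omega> in iid_law \<mu> f0. 0 < h \<omega> f" if f: "f \<in> B" for f
  proof -
    have fd: "f \<in> prob_densities \<mu>" and less: "kl_div \<mu> f0 f < ereal \<epsilon>"
      using f F by (auto simp: B_def space_prior)
    note * = kl_div_less_imp[OF f0 fd less]
    define z where "z = (\<lambda>x. ln (f0 x / f x) - \<epsilon>)"
    have "integrable (density \<mu> f0) z" "(\<integral>x. z x \<partial>density \<mu> f0) < 0"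
      using *(2,3) D0.prob_space by (auto simp: z_def)
    then have bdd: "AE \<omega> in iid_law \<mu> f0. bdd_above (range (\<lambda>n. \<Sum>i<n. z (\<omega> i)))"
      unfolding iid_law_def by (rule D.AE_bdd_above_partial_sums)
    have "AE \<omega> in iid_law \<mu> f0. 0 < f0 (\<omega> i) \<and> 0 < f (\<omega> i)" for i
      unfolding iid_law_def using *(1) D0.prob_space_axioms by (intro AE_PiM_component) auto
    then have "AE \<omega> in iid_law \<mu> f0. \<forall>i. 0 < f0 (\<omega> i) \<and> 0 < f (\<omega> i)"
      by (simp add: AE_all_countable)
    with bdd show ?thesis
    proof eventually_elim
      case (elim \<omega>)
      then obtain C where C: "(\<Sum>i<n. z (\<omega> i)) \<le> C" for n
        by (auto simp: bdd_above_def)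
      have "exp (- C) \<le> exp (real n * \<epsilon>) * likelihood_ratio f0 n \<omega> f" for n
      proof -
        have "exp (- z (\<omega> i)) = exp \<epsilon> * (f (\<omega> i) / f0 (\<omega> i))" for i
        proof -
          have "0 < f0 (\<omega> i)" "0 < f (\<omega> i)" using elim by auto
          then show ?thesis
            by (simp add: z_def exp_diff exp_minus field_simps)
        qed
        then have "exp (real n * \<epsilon>) * likelihood_ratio f0 n \<omega> f = (\<Prod>i<n. exp (- z (\<omega> i)))"
          by (simp only: likelihood_ratio_def prod.distrib) (simp add: exp_of_nat_mult)
        also have "\<dots> = exp (- (\<Sum>i<n. z (\<omega> i)))"
          by (simp add: exp_sum[symmetric] sum_negf)
        finally show ?thesis
          using C[of n] by simp
      qed
      then have "ennreal (exp (- C)) \<le> h \<omega> f"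
        unfolding h_def by (intro INF_greatest ennreal_leI)
      moreover have "0 < ennreal (exp (- C))" by simp
      ultimately show ?case by (rule less_le_trans[rotated])
    qed
  qed
  have "AE f in prior. AE \<omega> in iid_law \<mu> f0. f \<in> B \<longrightarrow> 0 < h \<omega> f"
    by (rule AE_I2, rule AE_impI, rule h_pos)
  then have "AE \<omega> in iid_law \<mu> f0. AE f in prior. f \<in> B \<longrightarrow> 0 < h \<omega> f"
    by (subst AE_commute) measurable
  then show ?thesis
  proof eventually_elim
    case (elim \<omega>)
    have [measurable]: "h \<omega> \<in> borel_measurable prior"
      using measurable_compose_Pair1[OF _ h_meas, of \<omega>] by simp
    have [measurable]: "likelihood_ratio f0 n \<omega> \<in> borel_measurable prior" for n
      using measurable_compose_Pair1[of \<omega> "iid_law \<mu> f0" "\<lambda>(\<omega>, f). likelihood_ratio f0 n \<omega> f" prior borel]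
      by simp
    have "(\<integral>\<^sup>+f\<in>B. h \<omega> f \<partial>prior) \<noteq> 0"
    proof
      assume "(\<integral>\<^sup>+f\<in>B. h \<omega> f \<partial>prior) = 0"
      then have "AE f in prior. h \<omega> f * indicator B f = 0"
        by (subst (asm) nn_integral_0_iff_AE) auto
      with elim have "AE f in prior. f \<notin> B"
        by eventually_elim (auto simp: indicator_def)
      then have "emeasure prior B = 0"
        by (subst (asm) AE_iff_measurable[OF B]) (auto dest: sets.sets_into_space[OF B, THEN subsetD])
      with B_pos show False by simp
    qed
    \<comment> \<open>Only a real lower bound is needed, so any positive \<open>c\<close> serves if the integral is infinite.\<close>
    then obtain c where c: "0 < c" "ennreal c \<le> (\<integral>\<^sup>+f\<in>B. h \<omega> f \<partial>prior)"
    proof (cases "\<integral>\<^sup>+f\<in>B. h \<omega> f \<partial>prior")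
      case (real r)
      with \<open>(\<integral>\<^sup>+f\<in>B. h \<omega> f \<partial>prior) \<noteq> 0\<close> show ?thesis by (intro that[of r]) auto
    next
      case top
      then show ?thesis by (intro that[of 1]) auto
    qed
    have "ennreal (c * exp (- real n * \<epsilon>)) \<le> avg_ratio n F \<omega>" for n
    proof -
      have "ennreal c \<le> (\<integral>\<^sup>+f\<in>B. h \<omega> f \<partial>prior)" by fact
      also have "\<dots> \<le> (\<integral>\<^sup>+f. ennreal (exp (real n * \<epsilon>)) * (ennreal (likelihood_ratio f0 n \<omega> f) * indicator F f) \<partial>prior)"
      proof (rule nn_integral_mono)
        fix f assume f: "f \<in> space prior"
        have "h \<omega> f \<le> ennreal (exp (real n * \<epsilon>) * likelihood_ratio f0 n \<omega> f)"
          unfolding h_def by (rule INF_lower) auto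
        with f show "h \<omega> f * indicator B f
            \<le> ennreal (exp (real n * \<epsilon>)) * (ennreal (likelihood_ratio f0 n \<omega> f) * indicator F f)"
          by (auto simp: indicator_def space_prior ennreal_mult')
      qed
      also have "\<dots> = ennreal (exp (real n * \<epsilon>)) * avg_ratio n F \<omega>"
        unfolding avg_ratio_def by (rule nn_integral_cmult) measurable
      finally have "ennreal (exp (- real n * \<epsilon>)) * ennreal c
          \<le> ennreal (exp (- real n * \<epsilon>)) * (ennreal (exp (real n * \<epsilon>)) * avg_ratio n F \<omega>)"
        by (intro mult_left_mono) auto
      then show ?thesis
        using c by (simp add: mult.assoc[symmetric] ennreal_mult[symmetric] exp_add[symmetric] mult.commute)
    qed
    with c show ?case by blast
  qed
qed

section \<open>Posterior decay and truncated moments\<close>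

lemma measurable_limsup_cylinders [measurable]:
  assumes "\<And>n. D n \<in> sets (sample_space \<mu> n)"
  shows "limsup_cylinders D \<in> sets (\<Pi>\<^sub>M i\<in>UNIV. \<mu>)"
proof -
  have [measurable]: "cylinder n (D n) \<in> sets (\<Pi>\<^sub>M i\<in>UNIV. \<mu>)" for n
    by (rule measurable_cylinder[OF assms])
  have "{\<omega> \<in> space (\<Pi>\<^sub>M i\<in>UNIV. \<mu>). \<exists>\<^sub>\<infinity>n. \<omega> \<in> cylinder n (D n)} \<in> sets (\<Pi>\<^sub>M i\<in>UNIV. \<mu>)"
    unfolding INFM_nat by measurable
  then show ?thesis
    by (simp add: limsup_cylinders_def space_PiM space_mu)
qed

lemma emeasure_limsup_cylinders_eq_0_iff:
  assumes "\<And>n. D n \<in> sets (sample_space \<mu> n)"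
  shows "emeasure (iid_law \<mu> f0) (limsup_cylinders D) = 0
    \<longleftrightarrow> (AE \<omega> in iid_law \<mu> f0. \<forall>\<^sub>F n in sequentially. \<omega> \<notin> cylinder n (D n))"
  using measurable_limsup_cylinders[OF assms]
  by (subst AE_iff_measurable[where N = "limsup_cylinders D"])
    (auto simp: limsup_cylinders_def not_eventually cofinite_eq_sequentially)

lemma cylinder_space_diff: "cylinder n (space (sample_space \<mu> n) - E) = - cylinder n E"
  by (auto simp: cylinder_def space_sample_space)

lemma truncated_moment_1:
  assumes "A \<in> sets prior" and [measurable]: "D \<in> sets (sample_space \<mu> n)"
  shows "truncated_moment \<mu> prior f0 A n D 1
    = (\<integral>\<^sup>+f\<in>A. emeasure (iid_law \<mu> f)
        (cylinder n ((space (sample_space \<mu> n) - D) \<inter> support_samples n)) \<partial>prior)"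
  unfolding truncated_moment_def ennreal_powr_1
  unfolding avg_ratio_def[symmetric] using assms by (intro nn_integral_avg_ratio) auto

lemma null_of_posterior_decay:
  assumes "AE \<omega> in iid_law \<mu> f0. (\<lambda>n. ennreal (exp (real n * \<beta>)) * posterior prior n \<omega> (A n)) \<longlonglongrightarrow> 0"
  shows "emeasure (iid_law \<mu> f0)
    {\<omega>. \<exists>\<^sub>\<infinity>n. posterior prior n \<omega> (A n) > ennreal (exp (- real n * \<beta>))} = 0"
proof -
  have "AE \<omega> in iid_law \<mu> f0. \<not> (\<exists>\<^sub>\<infinity>n. posterior prior n \<omega> (A n) > ennreal (exp (- real n * \<beta>)))"
    using assms
  proof eventually_elim
    case (elim \<omega>)
    then have "\<forall>\<^sub>F n in sequentially. ennreal (exp (real n * \<beta>)) * posterior prior n \<omega> (A n) < 1"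
      by (rule order_tendstoD) simp
    then have "\<forall>\<^sub>F n in sequentially. posterior prior n \<omega> (A n) \<le> ennreal (exp (- real n * \<beta>))"
    proof eventually_elim
      case (elim n)
      then have "ennreal (exp (- real n * \<beta>)) * (ennreal (exp (real n * \<beta>)) * posterior prior n \<omega> (A n))
          \<le> ennreal (exp (- real n * \<beta>)) * 1"
        by (intro mult_left_mono) auto
      then show ?case
        by (simp add: mult.assoc[symmetric] ennreal_mult[symmetric] exp_add[symmetric])
    qed
    then show ?case
      by (simp add: not_frequently not_less cofinite_eq_sequentially)
  qed
  from emeasure_eq_0_AE[OF this] show ?thesis by simp
qed

text \<open>
  Take for \<open>D\<^sub>n\<close> the samples whose posterior mass exceeds \<open>exp (- n \<beta>)\<close>; its limsup is the given null
  event.  The resulting bound \<open>2 exp (- n \<beta> \<alpha>)\<close> is below \<open>exp (- n \<beta> \<alpha> / 2)\<close> for large \<open>n\<close>.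
\<close>

lemma truncated_moment_of_null:
  assumes A: "\<And>n. A n \<in> sets prior" and "0 < \<beta>" "0 < \<alpha>" "\<alpha> \<le> 1"
    and null: "emeasure (iid_law \<mu> f0)
      {\<omega>. \<exists>\<^sub>\<infinity>n. posterior prior n \<omega> (A n) > ennreal (exp (- real n * \<beta>))} = 0"
  shows "\<exists>\<gamma> D. 0 < \<gamma> \<and> (\<forall>n. D n \<in> sets (sample_space \<mu> n)) \<and>
    emeasure (iid_law \<mu> f0) (limsup_cylinders D) = 0 \<and>
    (\<forall>\<^sub>F n in sequentially. truncated_moment \<mu> prior f0 (A n) n (D n) \<alpha> \<le> ennreal (exp (- real n * \<gamma>)))"
proof -
  define D where "D n = {x \<in> space (sample_space \<mu> n).
    posterior prior n x (A n) > ennreal (exp (- real n * \<beta>))}" for n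
  have [measurable]: "(\<lambda>x. posterior prior n x (A n)) \<in> borel_measurable (sample_space \<mu> n)" for n
    using A by (intro measurable_posterior) auto
  have D [measurable]: "D n \<in> sets (sample_space \<mu> n)" for n
    unfolding D_def by measurable
  have cyl: "\<omega> \<in> cylinder n (D n) \<longleftrightarrow> posterior prior n \<omega> (A n) > ennreal (exp (- real n * \<beta>))" for \<omega> n
    by (simp add: cylinder_def D_def posterior_restrict space_sample_space)
  have "truncated_moment \<mu> prior f0 (A n) n (D n) \<alpha> \<le> ennreal (2 * exp (- real n * (\<beta> * \<alpha>)))" for n
  proof -
    let ?c = "exp (- real n * \<beta>)"
    have "truncated_moment \<mu> prior f0 (A n) n (D n) \<alpha>
        \<le> (\<integral>\<^sup>+\<omega>. ennreal (?c powr \<alpha>) * (1 + avg_ratio n F \<omega>) \<partial>iid_law \<mu> f0)"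
      unfolding truncated_moment_def avg_ratio_def[symmetric]
    proof (rule nn_integral_mono)
      fix \<omega>
      have "indicator (cylinder n (space (sample_space \<mu> n) - D n)) \<omega> * avg_ratio n (A n) \<omega>
          \<le> ennreal ?c * avg_ratio n F \<omega>"
        using avg_ratio_le_of_posterior_le[OF A, of n \<omega> n ?c]
        by (auto simp: cylinder_space_diff cyl not_less indicator_def)
      then show "ennreal_powr (indicator (cylinder n (space (sample_space \<mu> n) - D n)) \<omega> * avg_ratio n (A n) \<omega>) \<alpha>
          \<le> ennreal (?c powr \<alpha>) * (1 + avg_ratio n F \<omega>)"
        using assms by (intro ennreal_powr_le) auto
    qed
    also have "\<dots> = ennreal (?c powr \<alpha>) * (1 + (\<integral>\<^sup>+\<omega>. avg_ratio n F \<omega> \<partial>iid_law \<mu> f0))"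
      using prob_space.emeasure_space_1[OF prob_space_iid_law[OF f0]]
      by (simp add: nn_integral_cmult nn_integral_add)
    also have "\<dots> \<le> ennreal (?c powr \<alpha>) * (1 + 1)"
      by (intro mult_left_mono add_left_mono nn_integral_avg_ratio_le_1) auto
    also have "\<dots> = ennreal (2 * exp (- real n * (\<beta> * \<alpha>)))"
      by (simp add: powr_def ennreal_mult mult.commute mult.left_commute)
    finally show ?thesis .
  qed
  moreover have "\<forall>\<^sub>F n in sequentially. 2 * exp (- real n * (\<beta> * \<alpha>)) \<le> exp (- real n * (\<beta> * \<alpha> / 2))"
  proof -
    obtain N :: nat where N: "2 / (\<beta> * \<alpha>) < real N"
      using reals_Archimedean2 by blast
    have "2 * exp (- real n * (\<beta> * \<alpha>)) \<le> exp (- real n * (\<beta> * \<alpha> / 2))" if "n \<ge> N" for n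
    proof -
      have "2 / (\<beta> * \<alpha>) \<le> real n" using N that by linarith
      then have "2 \<le> 1 + real n * (\<beta> * \<alpha> / 2)"
        using assms by (simp add: field_simps)
      also have "\<dots> \<le> exp (real n * (\<beta> * \<alpha> / 2))"
        by (rule exp_ge_add_one_self)
      finally have "2 * exp (- real n * (\<beta> * \<alpha>)) \<le> exp (real n * (\<beta> * \<alpha> / 2)) * exp (- real n * (\<beta> * \<alpha>))"
        by (rule mult_right_mono) simp
      also have "\<dots> = exp (- real n * (\<beta> * \<alpha> / 2))"
        by (simp add: exp_add[symmetric] algebra_simps)
      finally show ?thesis .
    qed
    then show ?thesis by (auto simp: eventually_sequentially)
  qed
  ultimately have "\<forall>\<^sub>F n in sequentially.
      truncated_moment \<mu> prior f0 (A n) n (D n) \<alpha> \<le> ennreal (exp (- real n * (\<beta> * \<alpha> / 2)))"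
    by (auto elim!: eventually_mono intro: order_trans ennreal_leI)
  moreover have "emeasure (iid_law \<mu> f0) (limsup_cylinders D) = 0"
    using null by (simp add: limsup_cylinders_def cyl)
  moreover have "0 < \<beta> * \<alpha> / 2" using assms by simp
  ultimately show ?thesis using D by blast
qed

text \<open>
  With rate \<open>\<beta> / 2\<close> for the almost sure decay of the power, the numerator itself decays at rate
  \<open>\<delta> = \<beta> / (2 \<alpha>)\<close>.  The denominator costs \<open>\<delta> / 4\<close>, the factor \<open>exp (n \<delta> / 2)\<close> costs \<open>\<delta> / 2\<close>, and \<open>\<delta> / 4\<close>
  remains for convergence to \<open>0\<close>.
\<close>

lemma posterior_decay_of_truncated_moment:
  assumes kl: "kl_support \<mu> prior f0" and A: "\<And>n. A n \<in> sets prior"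
    and D: "\<And>n. D n \<in> sets (sample_space \<mu> n)" and "0 < \<alpha>" "0 < \<beta>"
    and null: "emeasure (iid_law \<mu> f0) (limsup_cylinders D) = 0"
    and moment: "\<forall>\<^sub>F n in sequentially.
      truncated_moment \<mu> prior f0 (A n) n (D n) \<alpha> \<le> ennreal (exp (- real n * \<beta>))"
  shows "\<exists>\<beta>\<^sub>0>0. AE \<omega> in iid_law \<mu> f0.
    (\<lambda>n. ennreal (exp (real n * \<beta>\<^sub>0)) * posterior prior n \<omega> (A n)) \<longlonglongrightarrow> 0"
proof -
  interpret P0: prob_space "iid_law \<mu> f0"
    using f0 by (rule prob_space_iid_law)
  define \<delta> where "\<delta> = \<beta> / (2 * \<alpha>)"
  have \<delta>: "0 < \<delta>" using assms by (simp add: \<delta>_def)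
  define W where "W n \<omega> = ennreal_powr
    (indicator (cylinder n (space (sample_space \<mu> n) - D n)) \<omega> * avg_ratio n (A n) \<omega>) \<alpha>" for n \<omega>
  have [measurable]: "avg_ratio n (A n) \<in> borel_measurable (\<Pi>\<^sub>M i\<in>UNIV. \<mu>)"
    "cylinder n (space (sample_space \<mu> n) - D n) \<in> sets (\<Pi>\<^sub>M i\<in>UNIV. \<mu>)" for n
    using A D by (auto intro!: measurable_avg_ratio_iid_law measurable_cylinder)
  have "W n \<in> borel_measurable (iid_law \<mu> f0)" for n
    unfolding W_def by measurable
  moreover have "\<forall>\<^sub>F n in sequentially. (\<integral>\<^sup>+\<omega>. W n \<omega> \<partial>iid_law \<mu> f0) \<le> ennreal (exp (- real n * \<beta>))"
    using moment by (simp add: W_def truncated_moment_def avg_ratio_def)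
  ultimately have "AE \<omega> in iid_law \<mu> f0. \<forall>\<^sub>F n in sequentially. W n \<omega> \<le> ennreal (exp (- real n * (\<beta> / 2)))"
    using \<open>0 < \<beta>\<close> by (intro P0.AE_eventually_le_exp) auto
  moreover have "AE \<omega> in iid_law \<mu> f0. \<forall>\<^sub>F n in sequentially. \<omega> \<notin> cylinder n (D n)"
    using null emeasure_limsup_cylinders_eq_0_iff[of D] D by simp
  moreover have "AE \<omega> in iid_law \<mu> f0. \<exists>c>0. \<forall>n. ennreal (c * exp (- real n * (\<delta> / 4))) \<le> avg_ratio n F \<omega>"
    using \<delta> by (intro AE_avg_ratio_lower_bound kl) simp
  ultimately have "AE \<omega> in iid_law \<mu> f0.
      (\<lambda>n. ennreal (exp (real n * (\<delta> / 2))) * posterior prior n \<omega> (A n)) \<longlonglongrightarrow> 0"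
    using AE_f0_pos
  proof eventually_elim
    case (elim \<omega>)
    then obtain c where c: "0 < c" "\<And>n. ennreal (c * exp (- real n * (\<delta> / 4))) \<le> avg_ratio n F \<omega>"
      by auto
    have ev: "\<forall>\<^sub>F n in sequentially. ennreal (exp (real n * (\<delta> / 2))) * posterior prior n \<omega> (A n)
        \<le> ennreal (exp (- (\<delta> / 4)) ^ n / c)"
      using elim(1,2)
    proof eventually_elim
      case (elim n)
      then have "indicator (cylinder n (space (sample_space \<mu> n) - D n)) \<omega> * avg_ratio n (A n) \<omega>
          \<le> ennreal (exp (- real n * (\<beta> / 2)) powr (1 / \<alpha>))"
        using \<open>0 < \<alpha>\<close> unfolding W_def by (intro le_of_ennreal_powr_le) auto
      then have "avg_ratio n (A n) \<omega> \<le> ennreal (exp (- real n * \<delta>))"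
        using elim by (simp add: cylinder_space_diff powr_def \<delta>_def field_simps)
      then have "posterior prior n \<omega> (A n) \<le> ennreal (exp (- real n * \<delta>) / (c * exp (- real n * (\<delta> / 4))))"
        using A c \<open>\<forall>i. 0 < f0 (\<omega> i)\<close> by (intro posterior_le_of_avg_ratio) auto
      then have "ennreal (exp (real n * (\<delta> / 2))) * posterior prior n \<omega> (A n)
          \<le> ennreal (exp (real n * (\<delta> / 2))) * ennreal (exp (- real n * \<delta>) / (c * exp (- real n * (\<delta> / 4))))"
        by (rule mult_left_mono) simp
      also have "\<dots> = ennreal (exp (real n * (\<delta> / 2)) * (exp (- real n * \<delta>) / (c * exp (- real n * (\<delta> / 4)))))"
        using c by (simp add: ennreal_mult[symmetric])
      also have "exp (real n * (\<delta> / 2)) * (exp (- real n * \<delta>) / (c * exp (- real n * (\<delta> / 4))))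
          = exp (real n * (\<delta> / 2) + - real n * \<delta> - - real n * (\<delta> / 4)) / c"
        by (simp only: exp_add exp_diff) (simp add: field_simps)
      also have "real n * (\<delta> / 2) + - real n * \<delta> - - real n * (\<delta> / 4) = real n * (- (\<delta> / 4))"
        by (simp add: field_simps)
      also have "exp \<dots> = exp (- (\<delta> / 4)) ^ n"
        by (rule exp_of_nat_mult)
      finally show ?case .
    qed
    have "(\<lambda>n. exp (- (\<delta> / 4)) ^ n / c) \<longlonglongrightarrow> 0 / c"
      using \<delta> c by (intro tendsto_divide LIMSEQ_power_zero tendsto_const) auto
    then have lim: "(\<lambda>n. ennreal (exp (- (\<delta> / 4)) ^ n / c)) \<longlonglongrightarrow> 0"
      using tendsto_ennrealI by fastforce
    show ?case
      by (rule tendsto_sandwich[OF _ ev tendsto_const lim]) simp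
  qed
  with \<delta> show ?thesis
    by (intro exI[of _ "\<delta> / 2"]) auto
qed

lemma truncated_moment_le_prior_mass:
  assumes "A \<in> sets prior" and [measurable]: "D \<in> sets (sample_space \<mu> n)"
  shows "truncated_moment \<mu> prior f0 A n D 1
    \<le> (\<integral>\<^sup>+f\<in>A. emeasure (iid_law \<mu> f) (cylinder n (space (sample_space \<mu> n) - D)) \<partial>prior)"
proof -
  have "cylinder n (space (sample_space \<mu> n) - D) \<in> sets (iid_law \<mu> f)" for f
    unfolding sets_iid_law by (rule measurable_cylinder) measurable
  then show ?thesis
    unfolding truncated_moment_1[OF assms]
    by (intro nn_integral_mono mult_right_mono emeasure_mono) (auto simp: cylinder_def)
qed

text \<open>
  Enlarging \<open>D\<^sub>n\<close> by the samples of true likelihood zero removes exactly the restriction to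
  \<open>support_samples\<close> in \<open>truncated_moment_1\<close>, and these samples almost surely never occur.
\<close>

lemma prior_mass_of_truncated_moment:
  assumes A: "\<And>n. A n \<in> sets prior" and [measurable]: "\<And>n. D n \<in> sets (sample_space \<mu> n)"
    and null: "emeasure (iid_law \<mu> f0) (limsup_cylinders D) = 0"
  shows "\<exists>E. (\<forall>n. E n \<in> sets (sample_space \<mu> n)) \<and>
    emeasure (iid_law \<mu> f0) (limsup_cylinders E) = 0 \<and>
    (\<forall>n. (\<integral>\<^sup>+f\<in>A n. emeasure (iid_law \<mu> f) (cylinder n (space (sample_space \<mu> n) - E n)) \<partial>prior)
      = truncated_moment \<mu> prior f0 (A n) n (D n) 1)"
proof (intro exI conjI allI)
  let ?E = "\<lambda>n. D n \<union> (space (sample_space \<mu> n) - support_samples n)"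
  show E: "?E n \<in> sets (sample_space \<mu> n)" for n
    by measurable
  have "AE \<omega> in iid_law \<mu> f0. \<forall>\<^sub>F n in sequentially. \<omega> \<notin> cylinder n (D n)"
    using null emeasure_limsup_cylinders_eq_0_iff[of D] assms by simp
  then have "AE \<omega> in iid_law \<mu> f0. \<forall>\<^sub>F n in sequentially. \<omega> \<notin> cylinder n (?E n)"
    using AE_f0_pos
  proof eventually_elim
    case (elim \<omega>)
    then show ?case
      by (auto elim!: eventually_mono
        simp: cylinder_def support_samples_def space_sample_space intro!: prod_pos cong: prod.cong_simp)
  qed
  then show "emeasure (iid_law \<mu> f0) (limsup_cylinders ?E) = 0"
    using emeasure_limsup_cylinders_eq_0_iff[of ?E] E by simp
  show "(\<integral>\<^sup>+f\<in>A n. emeasure (iid_law \<mu> f) (cylinder n (space (sample_space \<mu> n) - ?E n)) \<partial>prior)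
      = truncated_moment \<mu> prior f0 (A n) n (D n) 1" for n
  proof -
    have "space (sample_space \<mu> n) - ?E n = (space (sample_space \<mu> n) - D n) \<inter> support_samples n"
      by (auto simp: support_samples_def)
    then show ?thesis
      using A by (simp only: truncated_moment_1[OF A assms(2)])
  qed
qed

end

theorem theorem1:
  fixes \<mu> :: "'a::polish_space measure"
    and F :: "('a \<Rightarrow> real) set"
    and prior :: "('a \<Rightarrow> real) measure"
    and f0 :: "'a \<Rightarrow> real"
    and A :: "nat \<Rightarrow> ('a \<Rightarrow> real) set"
  assumes "space \<mu> = UNIV"
    and "sigma_finite_measure \<mu>"
    and "versions_of_densities \<mu> F"
    and "separable_space (hellinger_topology \<mu> F)"
    and "(\<lambda>(x, f). f x) \<in> borel_measurable (\<mu> \<Otimes>\<^sub>M hellinger_borel \<mu> F)"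
    and "prob_space prior"
    and "sets prior = sets (hellinger_borel \<mu> F)"
    and "f0 \<in> F"
    and "kl_support \<mu> prior f0"
    and "\<And>n. A n \<in> sets prior"
  shows
    "let
       i = (\<exists>\<beta>\<^sub>0>0. AE \<omega> in iid_law \<mu> f0.
              (\<lambda>n. ennreal (exp (real n * \<beta>\<^sub>0)) * posterior prior n \<omega> (A n)) \<longlonglongrightarrow> 0);
       ii = (\<exists>\<beta>\<^sub>1>0. emeasure (iid_law \<mu> f0)
              {\<omega>. \<exists>\<^sub>\<infinity>n. posterior prior n \<omega> (A n) > ennreal (exp (- real n * \<beta>\<^sub>1))} = 0);
       iii = (\<exists>\<alpha>\<^sub>1 \<beta>\<^sub>2 D. 0 < \<alpha>\<^sub>1 \<and> \<alpha>\<^sub>1 \<le> 1 \<and> 0 < \<beta>\<^sub>2 \<and>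
              (\<forall>n. D n \<in> sets (sample_space \<mu> n)) \<and>
              emeasure (iid_law \<mu> f0) (limsup_cylinders D) = 0 \<and>
              (\<forall>\<^sub>F n in sequentially.
                 truncated_moment \<mu> prior f0 (A n) n (D n) \<alpha>\<^sub>1 \<le> ennreal (exp (- real n * \<beta>\<^sub>2))));
       iv = (\<forall>\<alpha>. 0 < \<alpha> \<and> \<alpha> \<le> 1 \<longrightarrow> (\<exists>\<beta> D. 0 < \<beta> \<and>
              (\<forall>n. D n \<in> sets (sample_space \<mu> n)) \<and>
              emeasure (iid_law \<mu> f0) (limsup_cylinders D) = 0 \<and>
              (\<forall>\<^sub>F n in sequentially.
                 truncated_moment \<mu> prior f0 (A n) n (D n) \<alpha> \<le> ennreal (exp (- real n * \<beta>)))));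
       v = (\<exists>\<beta>\<^sub>3 D. 0 < \<beta>\<^sub>3 \<and>
              (\<forall>n. D n \<in> sets (sample_space \<mu> n)) \<and>
              emeasure (iid_law \<mu> f0) (limsup_cylinders D) = 0 \<and>
              (\<forall>\<^sub>F n in sequentially.
                 (\<integral>\<^sup>+f\<in>A n. emeasure (iid_law \<mu> f)
                     (cylinder n (space (sample_space \<mu> n) - D n)) \<partial>prior)
                 \<le> ennreal (exp (- real n * \<beta>\<^sub>3))))
     in (i \<longleftrightarrow> ii) \<and> (i \<longleftrightarrow> iii) \<and> (i \<longleftrightarrow> iv) \<and> (i \<longleftrightarrow> v)"
proof -
  interpret mu: sigma_finite_measure \<mu> by fact
  interpret prior: prob_space prior by fact
  have F: "F \<subseteq> prob_densities \<mu>"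
    using assms by (simp add: versions_of_densities_def)
  have space_prior: "space prior = F"
    using sets_eq_imp_space_eq[OF \<open>sets prior = sets (hellinger_borel \<mu> F)\<close>]
    by (simp add: hellinger_borel_def space_measure_of_conv)
  have "sets (\<mu> \<Otimes>\<^sub>M hellinger_borel \<mu> F) = sets (\<mu> \<Otimes>\<^sub>M prior)"
    using assms by (intro sets_pair_measure_cong) auto
  then have eval: "(\<lambda>(x, f). f x) \<in> borel_measurable (\<mu> \<Otimes>\<^sub>M prior)"
    using assms by (simp cong: measurable_cong_sets)
  interpret density_model \<mu> F prior f0
    using assms F space_prior eval by unfold_locales auto
  note A = assms(10)
  define i where "i = (\<exists>\<beta>\<^sub>0>0. AE \<omega> in iid_law \<mu> f0.
    (\<lambda>n. ennreal (exp (real n * \<beta>\<^sub>0)) * posterior prior n \<omega> (A n)) \<longlonglongrightarrow> 0)"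
  define ii where "ii = (\<exists>\<beta>\<^sub>1>0. emeasure (iid_law \<mu> f0)
    {\<omega>. \<exists>\<^sub>\<infinity>n. posterior prior n \<omega> (A n) > ennreal (exp (- real n * \<beta>\<^sub>1))} = 0)"
  define moment where "moment \<alpha> = (\<exists>\<beta> D. 0 < \<beta> \<and> (\<forall>n. D n \<in> sets (sample_space \<mu> n)) \<and>
    emeasure (iid_law \<mu> f0) (limsup_cylinders D) = 0 \<and>
    (\<forall>\<^sub>F n in sequentially.
      truncated_moment \<mu> prior f0 (A n) n (D n) \<alpha> \<le> ennreal (exp (- real n * \<beta>))))" for \<alpha>
  define v where "v = (\<exists>\<beta>\<^sub>3 D. 0 < \<beta>\<^sub>3 \<and> (\<forall>n. D n \<in> sets (sample_space \<mu> n)) \<and>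
    emeasure (iid_law \<mu> f0) (limsup_cylinders D) = 0 \<and>
    (\<forall>\<^sub>F n in sequentially.
      (\<integral>\<^sup>+f\<in>A n. emeasure (iid_law \<mu> f) (cylinder n (space (sample_space \<mu> n) - D n)) \<partial>prior)
      \<le> ennreal (exp (- real n * \<beta>\<^sub>3))))"
  have i_ii: "i \<Longrightarrow> ii"
    unfolding i_def ii_def
    by (elim exE conjE, intro exI conjI) (assumption, rule null_of_posterior_decay)
  have ii_moment: "ii \<Longrightarrow> moment \<alpha>" if "0 < \<alpha>" "\<alpha> \<le> 1" for \<alpha>
    unfolding ii_def moment_def by (elim exE conjE) (rule truncated_moment_of_null[OF A _ that])
  have moment_i: "moment \<alpha> \<Longrightarrow> i" if "0 < \<alpha>" for \<alpha>
    unfolding i_def moment_def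
    by (elim exE conjE) (rule posterior_decay_of_truncated_moment[OF \<open>kl_support \<mu> prior f0\<close> A _ that], auto)
  have moment_v: "moment 1 \<Longrightarrow> v"
  proof -
    assume "moment 1"
    then obtain \<beta> D where D: "0 < \<beta>" "\<forall>n. D n \<in> sets (sample_space \<mu> n)"
      "emeasure (iid_law \<mu> f0) (limsup_cylinders D) = 0"
      "\<forall>\<^sub>F n in sequentially. truncated_moment \<mu> prior f0 (A n) n (D n) 1 \<le> ennreal (exp (- real n * \<beta>))"
      unfolding moment_def by (elim exE conjE) (rule that)
    from prior_mass_of_truncated_moment[where A = A and D = D, OF A D(2)[rule_format] D(3)] obtain E where
      "\<forall>n. E n \<in> sets (sample_space \<mu> n)" "emeasure (iid_law \<mu> f0) (limsup_cylinders E) = 0"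
      "\<And>n. (\<integral>\<^sup>+f\<in>A n. emeasure (iid_law \<mu> f) (cylinder n (space (sample_space \<mu> n) - E n)) \<partial>prior)
        = truncated_moment \<mu> prior f0 (A n) n (D n) 1"
      by (elim exE conjE) (rule that, assumption, assumption, erule spec)
    with D(1,4) show v
      unfolding v_def by (intro exI[of _ \<beta>] exI[of _ E]) simp
  qed
  have v_moment: "v \<Longrightarrow> moment 1"
  proof -
    assume v
    then obtain \<beta> D where D: "0 < \<beta>" "\<forall>n. D n \<in> sets (sample_space \<mu> n)"
      "emeasure (iid_law \<mu> f0) (limsup_cylinders D) = 0"
      "\<forall>\<^sub>F n in sequentially.
        (\<integral>\<^sup>+f\<in>A n. emeasure (iid_law \<mu> f) (cylinder n (space (sample_space \<mu> n) - D n)) \<partial>prior)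
        \<le> ennreal (exp (- real n * \<beta>))"
      unfolding v_def by (elim exE conjE) (rule that)
    from D(4) have "\<forall>\<^sub>F n in sequentially.
        truncated_moment \<mu> prior f0 (A n) n (D n) 1 \<le> ennreal (exp (- real n * \<beta>))"
      by (rule eventually_mono) (rule order_trans[OF truncated_moment_le_prior_mass[OF A D(2)[rule_format]]])
    with D(1-3) show "moment 1"
      unfolding moment_def by (intro exI conjI)
  qed
  have i_moment: "i \<Longrightarrow> moment \<alpha>" if "0 < \<alpha>" "\<alpha> \<le> 1" for \<alpha>
    using i_ii ii_moment that by blast
  have i_moment_1: "i \<Longrightarrow> moment 1"
    by (rule i_moment) auto
  have moment_1_i: "moment 1 \<Longrightarrow> i"
    by (rule moment_i) auto
  have i_iff_ii: "i \<longleftrightarrow> ii"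
    using i_ii ii_moment[of 1] moment_1_i by auto
  have i_iff_iii: "i \<longleftrightarrow> (\<exists>\<alpha>. 0 < \<alpha> \<and> \<alpha> \<le> 1 \<and> moment \<alpha>)"
    using i_moment_1 moment_i by (meson order_refl zero_less_one)
  have i_iff_iv: "i \<longleftrightarrow> (\<forall>\<alpha>. 0 < \<alpha> \<and> \<alpha> \<le> 1 \<longrightarrow> moment \<alpha>)"
    using i_moment moment_1_i by (meson order_refl zero_less_one)
  have i_iff_v: "i \<longleftrightarrow> v"
    using i_moment_1 moment_1_i moment_v v_moment by blast
  have iii: "(\<exists>\<alpha>\<^sub>1 \<beta>\<^sub>2 D. 0 < \<alpha>\<^sub>1 \<and> \<alpha>\<^sub>1 \<le> 1 \<and> 0 < \<beta>\<^sub>2 \<and>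
      (\<forall>n. D n \<in> sets (sample_space \<mu> n)) \<and>
      emeasure (iid_law \<mu> f0) (limsup_cylinders D) = 0 \<and>
      (\<forall>\<^sub>F n in sequentially.
         truncated_moment \<mu> prior f0 (A n) n (D n) \<alpha>\<^sub>1 \<le> ennreal (exp (- real n * \<beta>\<^sub>2))))
    \<longleftrightarrow> (\<exists>\<alpha>. 0 < \<alpha> \<and> \<alpha> \<le> 1 \<and> moment \<alpha>)"
    by (simp add: moment_def)
  show ?thesis
    unfolding Let_def iii i_def[symmetric] ii_def[symmetric] v_def[symmetric] moment_def[symmetric]
    by (intro conjI i_iff_ii i_iff_iii i_iff_iv i_iff_v)
qed

end
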